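(* Let $F$ belong to the Hall class, the Weibull class or the bounded class. Suppose $F$ is continuously twice differentiable at $x$, $\int z^2w(z)\,dz<\infty$, $\left|\int zW(z)w(z)\,dz\right|<\infty$, $\xi_n^{-2}\psi_nn^{-1}\to0$, and there exists $\delta>0$ such that $M_n\to\delta$. Then the asymptotically optimal bandwidth is (up to a factor $1+o(1)$) $$h=\left(2\delta^{-1-3\gamma}m^{1+3\gamma}n^{-1}\frac{\int zW(z)w(z)\,dz}{\left(\int z^2w(z)\,dz\right)^2}\right)^{1/3}\times\begin{cases}A^\gamma\{\sqrt\alpha(\alpha+1)\}^{-2/3}&\text{for the Hall class}\\ (\kappa C)^{-1}(C^{-1}\ln(m/\delta))^{-\theta}&\text{for the Weibull class}\\ D^\gamma\{\sqrt{-\mu}(-\mu-1)\}^{-2/3}&\text{for the bounded class.}\end{cases}$$ If the optimal bandwidth converges to $0$, then $F^m(x)-\widehat F^m(x)$ with the optimal bandwidth has the asymptotic bias $$\nu_0\exp(-\delta)\delta^{1/3}m^{2/3}n^{-2/3}\times\begin{cases}(\alpha(\alpha+1)^{-1})^{1/3}&\text{for the Hall class}\\ 1&\text{for the Weibull class}\\ (\mu(\mu+1)^{-1})^{1/3}&\text{for the bounded class,}\end{cases}$$ where $\nu_0:=\left(2\int z^2w(z)\,dz\right)^{-1/3}\left(\int zW(z)w(z)\,dz\right)^{2/3}$.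
   Context: $X_1,\dots,X_n$ are i.i.d. with continuous distribution function $F$ with density $f$. All asymptotics are as $n\to\infty$; $m=m_n\to\infty$, $m/n\to0$, and $x=x_n\to\infty$ (for the bounded class $x=x_n\uparrow x^*$). $F$ belongs to one of the following classes. Hall class: there are $\alpha>0,\beta\ge 1/2,A>0,B\ne0$ with $x^{\alpha+\beta}\{1-F(x)-Ax^{-\alpha}(1+Bx^{-\beta})\}\to0$ as $x\to\infty$. Weibull class: there are $\kappa>0,C>0$ with $\exp(Cx^\kappa)\{1-F(x)-\exp(-Cx^\kappa)\}\to0$ as $x\to\infty$. Bounded class: there are $x^*\in\mathbb R,\mu<-2,\sigma\le-1/2,D>0,E\neq0$ with $(x^*-x)^{\mu+\sigma}\{1-F(x)-(x^*-x)^{-\mu}(D+E(x^*-x)^{-\sigma})\}\to0$ as $x\uparrow x^*$. For the Hall, Weibull, bounded class respectively: $\gamma:=\alpha^{-1}$, $0$, $\mu^{-1}$; $M_n:=m\times Ax^{-\alpha}$, $m\times\exp(-Cx^\kappa)$, $m\times D(x^*-x)^{-\mu}$; $\xi_n:=\alpha(\alpha+1)x^{-2}$, $\kappa^2C^2x^{2\kappa-2}$, $\mu(\mu+1)(x^*-x)^{-2}$; $\psi_n:=A^{-1}\alpha x^{\alpha-1}$, $\kappa Cx^{\kappa-1}\exp(Cx^\kappa)$, $-D^{-1}\mu(x^*-x)^{\mu-1}$. Also $\theta:=1-1/\kappa$. The kernel distribution estimator is $\widehat F(x)=\frac1n\sum_{i=1}^nW\left(\frac{x-X_i}{h}\right)$,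 where $W$ is a smooth cumulative distribution function whose density $w=W'$ is symmetric and bounded, and has bounded support when $F$ has bounded support. The bandwidth $h=h_n>0$ satisfies $h\to0$ and, for the bounded class, $h(x^*-x)^{-1}\to0$. $\widehat F^m(x)=(\widehat F(x))^m$. The asymptotically optimal bandwidth is the $h>0$ minimizing the asymptotic expression of $\exp(2M_n)\mathbb E[(F^m(x)-\widehat F^m(x))^2]$ that retains the leading $h$-dependent variance term, namely $$M_n^2h^4\frac{\xi_n^2}{4}\left(\int z^2w(z)\,dz\right)^2+\frac mn\left(M_n-2mh f(x)\int zW(z)w(z)\,dz\right),$$ where $f(x)$ is replaced by its leading term $A\alpha x^{-\alpha-1}$, $\kappa Cx^{\kappa-1}\exp(-Cx^\kappa)$, $-D\mu(x^*-x)^{-\mu-1}$ for the Hall, Weibull, bounded class respectively. That $F^m(x)-\widehat F^m(x)$ has asymptotic bias $\beta_n$ means that, after subtracting $\beta_n(1+o(1))$ and dividing by a suitable deterministic positive sequence, it converges in distribution to the standard normal distribution.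
   Formalization: The bias claim additionally assumes that, at the optimal bandwidth, exp(2M_n)E[(F^m(x)-F̂^m(x))^2] is asymptotically equal to the displayed expression minimized by h; without this it fails, e.g. for heavy-tailed kernels in the Hall class. *)

theory Defs
  imports "HOL-Probability.Probability" "HOL-Library.Landau_Symbols"
begin

datatype tail_class =
    Hall real real real real  \<comment> \<open>\<open>\<alpha> \<beta> A B\<close>\<close>
  | Weibull real real  \<comment> \<open>\<open>\<kappa> C\<close>\<close>
  | Bounded real real real real real  \<comment> \<open>\<open>x\<^sup>* \<mu> \<sigma> D E\<close>\<close>

fun in_class :: "(real \<Rightarrow> real) \<Rightarrow> tail_class \<Rightarrow> bool" where
  "in_class F (Hall \<alpha> \<beta> A B) \<longleftrightarrow>
     \<alpha> > 0 \<and> \<beta> \<ge> 1/2 \<and> A > 0 \<and> B \<noteq> 0 \<and>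
     ((\<lambda>x. x powr (\<alpha> + \<beta>) * (1 - F x - A * x powr (-\<alpha>) * (1 + B * x powr (-\<beta>)))) \<longlongrightarrow> 0) at_top"
| "in_class F (Weibull \<kappa> C) \<longleftrightarrow>
     \<kappa> > 0 \<and> C > 0 \<and>
     ((\<lambda>x. exp (C * x powr \<kappa>) * (1 - F x - exp (- C * x powr \<kappa>))) \<longlongrightarrow> 0) at_top"
| "in_class F (Bounded xs \<mu> \<sigma> D E) \<longleftrightarrow>
     \<mu> < -2 \<and> \<sigma> \<le> -1/2 \<and> D > 0 \<and> E \<noteq> 0 \<and>
     ((\<lambda>x. (xs - x) powr (\<mu> + \<sigma>) *
          (1 - F x - (xs - x) powr (-\<mu>) * (D + E * (xs - x) powr (-\<sigma>)))) \<longlongrightarrow> 0) (at_left xs)"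

text \<open>The filter along which the point \<open>x\<^sub>n\<close> approaches the right endpoint of \<open>F\<close>.\<close>

fun endpoint_filter :: "tail_class \<Rightarrow> real filter" where
  "endpoint_filter (Hall \<alpha> \<beta> A B) = at_top"
| "endpoint_filter (Weibull \<kappa> C) = at_top"
| "endpoint_filter (Bounded xs \<mu> \<sigma> D E) = at_left xs"

fun gam :: "tail_class \<Rightarrow> real" where
  "gam (Hall \<alpha> \<beta> A B) = 1 / \<alpha>"
| "gam (Weibull \<kappa> C) = 0"
| "gam (Bounded xs \<mu> \<sigma> D E) = 1 / \<mu>"

text \<open>The leading term of \<open>1 - F\<close>; thus \<open>M\<^sub>n = m * lead_tail p x\<close>.\<close>

fun lead_tail :: "tail_class \<Rightarrow> real \<Rightarrow> real" where
  "lead_tail (Hall \<alpha> \<beta> A B) x = A * x powr (-\<alpha>)"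
| "lead_tail (Weibull \<kappa> C) x = exp (- C * x powr \<kappa>)"
| "lead_tail (Bounded xs \<mu> \<sigma> D E) x = D * (xs - x) powr (-\<mu>)"

text \<open>The leading term of the density.\<close>

fun lead_dens :: "tail_class \<Rightarrow> real \<Rightarrow> real" where
  "lead_dens (Hall \<alpha> \<beta> A B) x = A * \<alpha> * x powr (-\<alpha> - 1)"
| "lead_dens (Weibull \<kappa> C) x = \<kappa> * C * x powr (\<kappa> - 1) * exp (- C * x powr \<kappa>)"
| "lead_dens (Bounded xs \<mu> \<sigma> D E) x = - D * \<mu> * (xs - x) powr (-\<mu> - 1)"

fun xi :: "tail_class \<Rightarrow> real \<Rightarrow> real" where
  "xi (Hall \<alpha> \<beta> A B) x = \<alpha> * (\<alpha> + 1) * x powr (-2)"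
| "xi (Weibull \<kappa> C) x = \<kappa>\<^sup>2 * C\<^sup>2 * x powr (2 * \<kappa> - 2)"
| "xi (Bounded xs \<mu> \<sigma> D E) x = \<mu> * (\<mu> + 1) * (xs - x) powr (-2)"

fun psi :: "tail_class \<Rightarrow> real \<Rightarrow> real" where
  "psi (Hall \<alpha> \<beta> A B) x = inverse A * \<alpha> * x powr (\<alpha> - 1)"
| "psi (Weibull \<kappa> C) x = \<kappa> * C * x powr (\<kappa> - 1) * exp (C * x powr \<kappa>)"
| "psi (Bounded xs \<mu> \<sigma> D E) x = - inverse D * \<mu> * (xs - x) powr (\<mu> - 1)"

definition cont_twice_diff_at :: "(real \<Rightarrow> real) \<Rightarrow> real \<Rightarrow> bool" where
  "cont_twice_diff_at F x \<longleftrightarrow>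
     (\<exists>F' F''. (\<forall>\<^sub>F y in nhds x. (F has_real_derivative F' y) (at y) \<and>
                               (F' has_real_derivative F'' y) (at y)) \<and> isCont F'' x)"

text \<open>Smoothness of the kernel distribution function \<open>W\<close> is only used, and hence only
  required, in the form that \<open>W\<close> is continuously differentiable.\<close>

definition smoothing_kernel :: "(real \<Rightarrow> real) \<Rightarrow> (real \<Rightarrow> real) \<Rightarrow> bool" where
  "smoothing_kernel W w \<longleftrightarrow>
     mono W \<and> (W \<longlongrightarrow> 0) at_bot \<and> (W \<longlongrightarrow> 1) at_top \<and>
     (\<forall>z. (W has_real_derivative w z) (at z)) \<and> continuous_on UNIV w \<and>
     (\<forall>z. w (-z) = w z) \<and> bounded (range w)"

text \<open>The observations are numbered from \<open>0\<close>.\<close>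

definition Fhat :: "(real \<Rightarrow> real) \<Rightarrow> real \<Rightarrow> nat \<Rightarrow> (nat \<Rightarrow> 'a \<Rightarrow> real) \<Rightarrow> real \<Rightarrow> 'a \<Rightarrow> real" where
  "Fhat W h n X x \<omega> = (\<Sum>i<n. W ((x - X i \<omega>) / h)) / real n"

text \<open>The asymptotic expression of \<open>exp (2 M\<^sub>n)\<close> times the mean squared error, as a function
  of the bandwidth \<open>h\<close>, and its minimizer over \<open>h > 0\<close>.\<close>

definition amse ::
  "tail_class \<Rightarrow> (real \<Rightarrow> real) \<Rightarrow> (real \<Rightarrow> real) \<Rightarrow> nat \<Rightarrow> nat \<Rightarrow> real \<Rightarrow> real \<Rightarrow> real" where
  "amse p W w n m x h =
     (real m * lead_tail p x)\<^sup>2 * h ^ 4 * ((xi p x)\<^sup>2 / 4) * (LBINT z. z\<^sup>2 * w z)\<^sup>2 +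
     real m / real n *
       (real m * lead_tail p x - 2 * real m * h * lead_dens p x * (LBINT z. z * W z * w z))"

definition opt_bandwidth ::
  "tail_class \<Rightarrow> (real \<Rightarrow> real) \<Rightarrow> (real \<Rightarrow> real) \<Rightarrow> nat \<Rightarrow> nat \<Rightarrow> real \<Rightarrow> real" where
  "opt_bandwidth p W w n m x = arg_min (amse p W w n m x) (\<lambda>h. h > 0)"

fun bandwidth_factor :: "tail_class \<Rightarrow> real \<Rightarrow> real \<Rightarrow> real" where
  "bandwidth_factor (Hall \<alpha> \<beta> A B) m \<delta> = A powr (1 / \<alpha>) * (sqrt \<alpha> * (\<alpha> + 1)) powr (-2/3)"
| "bandwidth_factor (Weibull \<kappa> C) m \<delta> =
     inverse (\<kappa> * C) * (inverse C * ln (m / \<delta>)) powr (- (1 - 1 / \<kappa>))"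
| "bandwidth_factor (Bounded xs \<mu> \<sigma> D E) m \<delta> =
     D powr (1 / \<mu>) * (sqrt (-\<mu>) * (-\<mu> - 1)) powr (-2/3)"

fun bias_factor :: "tail_class \<Rightarrow> real" where
  "bias_factor (Hall \<alpha> \<beta> A B) = (\<alpha> * inverse (\<alpha> + 1)) powr (1/3)"
| "bias_factor (Weibull \<kappa> C) = 1"
| "bias_factor (Bounded xs \<mu> \<sigma> D E) = (\<mu> * inverse (\<mu> + 1)) powr (1/3)"

definition has_asymptotic_bias ::
  "'a measure \<Rightarrow> (nat \<Rightarrow> 'a \<Rightarrow> real) \<Rightarrow> (nat \<Rightarrow> real) \<Rightarrow> bool" where
  "has_asymptotic_bias M T b \<longleftrightarrow>
     (\<exists>b' s. b' \<sim>[sequentially] b \<and> (\<forall>n. s n > 0) \<and>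
        weak_conv_m (\<lambda>n. distr M borel (\<lambda>\<omega>. (T n \<omega> - b' n) / s n)) std_normal_distribution)"

end

theory Submission
  imports Defs
begin

text \<open>
The criterion minimized by the bandwidth is a quartic \<open>a h\<^sup>4 - d h\<close> plus a constant, with
\<open>a, d > 0\<close> because the kernel moments \<open>S\<close> and \<open>I\<close> are positive (\<open>kernel_second_moment_pos\<close>,
\<open>kernel_mixed_moment_pos\<close>). Its unique minimizer is the cube root of \<open>d / (4 a)\<close>
(\<open>opt_bandwidth_closed_form\<close>). Measured in units of a length scale of the tail at \<open>x\<close>
(\<open>tail_scale\<close>), the minimizer is \<open>(2 (m / n) (I / S\<^sup>2) / M)\<close> to the power \<open>1/3\<close> in all three classes, and
\<open>M \<rightarrow> \<delta>\<close> pins down the scale asymptotically (\<open>tail_scale_asymp\<close>). This gives the formula for the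
bandwidth.

For the bias, the optimal bandwidth is of smaller order than the tail scale. Hence the
criterion at the optimum is \<open>\<delta> m / n\<close> to leading order: the variance dominates, and the mean
squared error of \<open>Fhat\<^sup>m\<close> is asymptotically \<open>exp (- 2 \<delta>) \<delta> m / n\<close>. The estimator \<open>Fhat\<close> is a mean of
independent variables \<open>W ((x - X i) / h)\<close> in \<open>[0,1]\<close>. Writing \<open>q\<close> for the expectation of
\<open>1 - W ((x - X i) / h)\<close> and \<open>v\<close> for its variance, the size of the mean squared error forces
\<open>m q \<rightarrow> \<delta>\<close>, and observations a large multiple of \<open>h\<close> above \<open>x\<close>
(\<open>kernel_tail_second_moment_ge\<close>, \<open>lead_tail_shift\<close>) force \<open>m v \<rightarrow> \<delta>\<close>. A central limit theorem for
triangular arrays (\<open>char_normalized_sum_tendsto\<close>) and the delta method for the \<open>m\<close>-th power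
(\<open>power_of_mean_delta\<close>) then show that \<open>F\<^sup>m - Fhat\<^sup>m\<close> is asymptotically normal with standard deviation
\<open>s\<close>, where \<open>s\<^sup>2\<close> is \<open>exp (- 2 \<delta>) \<delta> m / n\<close> to leading order. As this already exhausts the mean squared
error, the squared bias is of smaller order than \<open>m / n\<close>.

Centring by any sequence of smaller order than \<open>s\<close> therefore yields the standard normal limit. The
stated bias is of order \<open>(m / n)\<close> to the power \<open>2/3\<close>, while \<open>s\<close> is of order \<open>(m / n)\<close> to the power
\<open>1/2\<close>, so it is such a sequence (\<open>power_of_mean_asymptotic_normality\<close>).
\<close>

section \<open>Sums of bounded independent variables\<close>

text \<open>The fourth moment is what makes the quadratic error of a linearization negligible in mean square,
not only in probability. For independent centred variables all odd cross terms in the expansion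
of \<open>(S + Z)\<^sup>4\<close> vanish, and \<open>\<bar>Z\<bar> \<le> 1\<close> bounds \<open>E Z\<^sup>4\<close> by \<open>E Z\<^sup>2\<close>, so the bound follows by induction
on the number of summands.\<close>

lemma (in prob_space) centred_sum_moments:
  fixes Z :: "nat \<Rightarrow> 'a \<Rightarrow> real"
  assumes indep: "indep_vars (\<lambda>_. borel) Z UNIV"
    and bd: "\<And>i \<omega>. \<bar>Z i \<omega>\<bar> \<le> 1"
    and mean: "\<And>i. expectation (Z i) = 0"
    and var: "\<And>i. expectation (\<lambda>\<omega>. (Z i \<omega>)\<^sup>2) = v"
  shows "expectation (\<lambda>\<omega>. \<Sum>i<k. Z i \<omega>) = 0"
    and "expectation (\<lambda>\<omega>. (\<Sum>i<k. Z i \<omega>)\<^sup>2) = real k * v"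
    and "expectation (\<lambda>\<omega>. (\<Sum>i<k. Z i \<omega>) ^ 4) \<le> real k * v + 3 * (real k * v)\<^sup>2"
proof -
  have rv [measurable]: "Z i \<in> borel_measurable M" for i
    using indep unfolding indep_vars_def2 by simp
  define S where "S k \<omega> = (\<Sum>i<k. Z i \<omega>)" for k \<omega>
  have [measurable]: "S k \<in> borel_measurable M" for k unfolding S_def by measurable
  have S_bd: "\<bar>S k \<omega>\<bar> \<le> real k" for k \<omega>
  proof -
    have "\<bar>S k \<omega>\<bar> \<le> (\<Sum>i<k. \<bar>Z i \<omega>\<bar>)" unfolding S_def by (rule sum_abs)
    also have "\<dots> \<le> (\<Sum>i<k. 1)" by (intro sum_mono bd)
    finally show ?thesis by simp
  qed
  have int: "integrable M (\<lambda>\<omega>. S k \<omega> ^ a * Z i \<omega> ^ b)" for k a i b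
  proof (rule integrable_const_bound[where B = "real k ^ a"])
    show "AE \<omega> in M. norm (S k \<omega> ^ a * Z i \<omega> ^ b) \<le> real k ^ a"
    proof (rule AE_I2)
      fix \<omega>
      have "\<bar>S k \<omega>\<bar> ^ a * \<bar>Z i \<omega>\<bar> ^ b \<le> real k ^ a * 1"
        by (intro mult_mono power_mono S_bd power_le_one bd) auto
      then show "norm (S k \<omega> ^ a * Z i \<omega> ^ b) \<le> real k ^ a"
        by (simp add: abs_mult power_abs)
    qed
  qed measurable
  have intS: "integrable M (\<lambda>\<omega>. S k \<omega> ^ a)" for k a using int[of k a 0 0] by simp
  have intZ: "integrable M (\<lambda>\<omega>. Z i \<omega> ^ b)" for i b using int[of 0 0 i b] by simp
  have prod: "expectation (\<lambda>\<omega>. S k \<omega> ^ a * Z k \<omega> ^ b) =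
      expectation (\<lambda>\<omega>. S k \<omega> ^ a) * expectation (\<lambda>\<omega>. Z k \<omega> ^ b)" for k a b
  proof -
    have "indep_var borel (Z k) borel (S k)"
      unfolding S_def[abs_def]
      by (rule indep_vars_sum) (auto intro: indep_vars_subset[OF indep])
    then have "indep_var borel ((\<lambda>z. z ^ b) \<circ> Z k) borel ((\<lambda>z. z ^ a) \<circ> S k)"
      by (rule indep_var_compose) auto
    from indep_var_lebesgue_integral[OF this] intS intZ show ?thesis
      by (simp add: comp_def mult.commute)
  qed
  have sq: "expectation (\<lambda>\<omega>. (Z i \<omega>) ^ 4) \<le> v" for i
  proof -
    have "expectation (\<lambda>\<omega>. (Z i \<omega>) ^ 4) \<le> expectation (\<lambda>\<omega>. (Z i \<omega>) ^ 2)"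
    proof (rule integral_mono[OF intZ intZ])
      fix \<omega>
      have "(Z i \<omega>)\<^sup>2 \<le> 1" using bd[of i \<omega>] by (simp add: abs_square_le_1)
      then have "(Z i \<omega>)\<^sup>2 * (Z i \<omega>)\<^sup>2 \<le> (Z i \<omega>)\<^sup>2 * 1" by (intro mult_left_mono) auto
      then show "(Z i \<omega>) ^ 4 \<le> (Z i \<omega>)\<^sup>2" by (simp add: power4_eq_xxxx power2_eq_square mult.assoc)
    qed
    then show ?thesis using var by simp
  qed
  have m1: "expectation (\<lambda>\<omega>. S k \<omega> ^ 1) = 0" for k
  proof -
    have "expectation (S k) = (\<Sum>i<k. expectation (Z i))"
      unfolding S_def[abs_def] using intZ[of _ 1] by (intro Bochner_Integration.integral_sum) simp
    then show ?thesis using mean by simp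
  qed
  have Z1: "expectation (\<lambda>\<omega>. Z i \<omega> ^ 1) = 0" for i using mean by simp
  have m2: "expectation (\<lambda>\<omega>. S k \<omega> ^ 2) = real k * v" for k
  proof (induction k)
    case 0 then show ?case by (simp add: S_def)
  next
    case (Suc k)
    have "expectation (\<lambda>\<omega>. S (Suc k) \<omega> ^ 2) =
        expectation (\<lambda>\<omega>. S k \<omega> ^ 2 + 2 * (S k \<omega> ^ 1 * Z k \<omega> ^ 1) + Z k \<omega> ^ 2)"
      by (intro Bochner_Integration.integral_cong) (auto simp: S_def power2_eq_square algebra_simps)
    also have "\<dots> = expectation (\<lambda>\<omega>. S k \<omega> ^ 2) + 2 * expectation (\<lambda>\<omega>. S k \<omega> ^ 1 * Z k \<omega> ^ 1)
        + expectation (\<lambda>\<omega>. Z k \<omega> ^ 2)"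
      using intS[of k 2] intZ[of k 2] int[of k 1 k 1] by simp
    finally show ?case unfolding prod m1 Suc.IH var by (simp add: algebra_simps)
  qed
  have v0: "v \<ge> 0" 
    using var[of 0] Bochner_Integration.integral_nonneg[of M "\<lambda>\<omega>. (Z 0 \<omega>)\<^sup>2"] by auto
  have m4: "expectation (\<lambda>\<omega>. S k \<omega> ^ 4) \<le> real k * v + 3 * (real k * v)\<^sup>2" for k
  proof (induction k)
    case 0 then show ?case by (simp add: S_def)
  next
    case (Suc k)
    have "expectation (\<lambda>\<omega>. S (Suc k) \<omega> ^ 4) =
        expectation (\<lambda>\<omega>. S k \<omega> ^ 4 + 4 * (S k \<omega> ^ 3 * Z k \<omega> ^ 1) + 6 * (S k \<omega> ^ 2 * Z k \<omega> ^ 2)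
          + 4 * (S k \<omega> ^ 1 * Z k \<omega> ^ 3) + Z k \<omega> ^ 4)"
      by (intro Bochner_Integration.integral_cong)
        (auto simp: S_def power2_eq_square power3_eq_cube power4_eq_xxxx algebra_simps)
    also have "\<dots> = expectation (\<lambda>\<omega>. S k \<omega> ^ 4) + 4 * expectation (\<lambda>\<omega>. S k \<omega> ^ 3 * Z k \<omega> ^ 1)
        + 6 * expectation (\<lambda>\<omega>. S k \<omega> ^ 2 * Z k \<omega> ^ 2) + 4 * expectation (\<lambda>\<omega>. S k \<omega> ^ 1 * Z k \<omega> ^ 3)
        + expectation (\<lambda>\<omega>. Z k \<omega> ^ 4)"
      using intS[of k 4] intZ[of k 4] int[of k 3 k 1] int[of k 2 k 2] int[of k 1 k 3] by simp
    also have "\<dots> = expectation (\<lambda>\<omega>. S k \<omega> ^ 4) + 6 * (real k * v * v) + expectation (\<lambda>\<omega>. Z k \<omega> ^ 4)"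
      unfolding prod m1 Z1 m2 var by simp
    also have "\<dots> \<le> real k * v + 3 * (real k * v)\<^sup>2 + 6 * (real k * v * v) + v"
      using Suc.IH sq[of k] by simp
    also have "\<dots> \<le> real (Suc k) * v + 3 * (real (Suc k) * v)\<^sup>2"
      using v0 by (simp add: algebra_simps power2_eq_square)
    finally show ?case .
  qed
  show "expectation (\<lambda>\<omega>. \<Sum>i<k. Z i \<omega>) = 0" using m1[of k] by (simp add: S_def)
  show "expectation (\<lambda>\<omega>. (\<Sum>i<k. Z i \<omega>)\<^sup>2) = real k * v" using m2[of k] by (simp add: S_def)
  show "expectation (\<lambda>\<omega>. (\<Sum>i<k. Z i \<omega>) ^ 4) \<le> real k * v + 3 * (real k * v)\<^sup>2"
    using m4[of k] by (simp add: S_def)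
qed

text \<open>The law of the summands changes with \<open>n\<close>, so this is a central limit theorem for a triangular
array. Since the summands are bounded, the third-order term of the characteristic function of
\<open>Z / sqrt (n v)\<close> is at most \<open>\<bar>t\<bar>\<^sup>3 / (6 n sqrt (n v))\<close>; summed over \<open>n\<close> factors this vanishes as soon as
the total variance \<open>n v\<close> diverges, and Lindeberg's condition comes for free.\<close>

lemma (in prob_space) char_normalized_sum_tendsto:
  fixes Z :: "nat \<Rightarrow> nat \<Rightarrow> 'a \<Rightarrow> real" and v :: "nat \<Rightarrow> real"
  assumes indep: "\<And>n. indep_vars (\<lambda>_. borel) (Z n) UNIV"
    and bd: "\<And>n i \<omega>. \<bar>Z n i \<omega>\<bar> \<le> 1"
    and mean: "\<And>n i. expectation (Z n i) = 0"
    and var: "\<And>n i. expectation (\<lambda>\<omega>. (Z n i \<omega>)\<^sup>2) = v n"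
    and lim: "filterlim (\<lambda>n. real n * v n) at_top sequentially"
  shows "(\<lambda>n. char (distr M borel (\<lambda>\<omega>. (\<Sum>i<n. Z n i \<omega>) / sqrt (real n * v n))) t)
    \<longlonglongrightarrow> char std_normal_distribution t"
proof -
  have rv [measurable]: "Z n i \<in> borel_measurable M" for n i
    using indep[of n] unfolding indep_vars_def2 by simp
  define \<phi> where "\<phi> n = char (distr M borel (\<lambda>\<omega>. (\<Sum>i<n. Z n i \<omega>) / sqrt (real n * v n))) t" for n
  have ev: "\<forall>\<^sub>F n in sequentially. real n * v n > 0" using lim by (auto simp: filterlim_at_top_dense)
  have "\<forall>\<^sub>F n in sequentially. n \<ge> nat \<lceil>t\<^sup>2 / 4\<rceil>" by (rule eventually_ge_at_top)
  with ev have main: "\<forall>\<^sub>F n in sequentially.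
      cmod (\<phi> n - complex_of_real ((1 + (-(t\<^sup>2) / 2) / real n) ^ n)) \<le> \<bar>t\<bar> ^ 3 / 6 / sqrt (real n * v n)"
  proof eventually_elim
    case (elim n)
    define u where "u = sqrt (real n * v n)"
    have u: "u > 0" "u\<^sup>2 = real n * v n" using elim by (auto simp: u_def)
    have n0: "n > 0" using elim by (cases n) auto
    have v0: "v n > 0" using elim by (simp add: zero_less_mult_iff)
    have tn: "t\<^sup>2 \<le> 4 * real n"
    proof -
      have "t\<^sup>2 / 4 \<le> real n" using elim by linarith
      then show ?thesis by simp
    qed
    have "\<phi> n = char (distr M borel (\<lambda>\<omega>. \<Sum>i<n. Z n i \<omega> / u)) t"
      by (simp add: \<phi>_def u_def sum_divide_distrib)
    also have "\<dots> = (\<Prod>i<n. char (distr M borel (\<lambda>\<omega>. Z n i \<omega> / u)) t)"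
      by (rule char_distr_sum, rule indep_vars_compose2[where X = "Z n"],
          rule indep_vars_subset[OF indep]) auto
    finally have eq: "\<phi> n = (\<Prod>i<n. char (distr M borel (\<lambda>\<omega>. Z n i \<omega> / u)) t)" .
    have int: "integrable M (\<lambda>\<omega>. Z n i \<omega>)" for i
      by (rule integrable_const_bound[where B = 1]) (use bd in auto)
    have int2: "integrable M (\<lambda>\<omega>. (Z n i \<omega>)\<^sup>2)" for i
      by (rule integrable_const_bound[where B = 1]) (use bd in \<open>auto simp: abs_square_le_1\<close>)
    have one: "cmod (char (distr M borel (\<lambda>\<omega>. Z n i \<omega> / u)) t - (1 + (-(t\<^sup>2) / 2) / real n))
        \<le> \<bar>t\<bar> ^ 3 / 6 / u / real n" for i
    proof -
      have intu: "integrable M (\<lambda>\<omega>. (Z n i \<omega> / u)\<^sup>2)"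
        using int2[of i] by (simp add: power_divide)
      have e2: "expectation (\<lambda>\<omega>. (Z n i \<omega> / u)\<^sup>2) = 1 / real n"
        using var[of n i] u v0 n0 by (simp add: power_divide)
      have "cmod (char (distr M borel (\<lambda>\<omega>. Z n i \<omega> / u)) t - (1 - t\<^sup>2 * (1 / real n) / 2)) \<le>
        (t\<^sup>2 / 6) * expectation (\<lambda>\<omega>. min (6 * (Z n i \<omega> / u)\<^sup>2) (\<bar>t\<bar> * \<bar>Z n i \<omega> / u\<bar> ^ 3))"
        by (rule char_approx3') (use int intu e2 mean[of n i] in auto)
      also have "\<dots> \<le> t\<^sup>2 / 6 * (\<bar>t\<bar> / u * (1 / real n))"
      proof (rule mult_left_mono)
      have "expectation (\<lambda>\<omega>. min (6 * (Z n i \<omega> / u)\<^sup>2) (\<bar>t\<bar> * \<bar>Z n i \<omega> / u\<bar> ^ 3))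
          \<le> expectation (\<lambda>\<omega>. (\<bar>t\<bar> / u) * (Z n i \<omega> / u)\<^sup>2)"
      proof (rule integral_mono)
        show "integrable M (\<lambda>\<omega>. min (6 * (Z n i \<omega> / u)\<^sup>2) (\<bar>t\<bar> * \<bar>Z n i \<omega> / u\<bar> ^ 3))"
          by (rule Bochner_Integration.integrable_bound[OF integrable_mult_right[OF intu, of 6]]) auto
        show "integrable M (\<lambda>\<omega>. (\<bar>t\<bar> / u) * (Z n i \<omega> / u)\<^sup>2)"
          using intu by simp
        fix \<omega>
        have "\<bar>t\<bar> * \<bar>Z n i \<omega> / u\<bar> ^ 3 = \<bar>Z n i \<omega>\<bar> * ((\<bar>t\<bar> / u) * (Z n i \<omega> / u)\<^sup>2)"
          using u(1) by (simp add: power3_eq_cube power2_eq_square mult_ac)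
        also have "\<dots> \<le> 1 * ((\<bar>t\<bar> / u) * (Z n i \<omega> / u)\<^sup>2)"
          by (intro mult_right_mono bd) (use u in auto)
        finally show "min (6 * (Z n i \<omega> / u)\<^sup>2) (\<bar>t\<bar> * \<bar>Z n i \<omega> / u\<bar> ^ 3) \<le> (\<bar>t\<bar> / u) * (Z n i \<omega> / u)\<^sup>2"
          by linarith
      qed
      also have "\<dots> = \<bar>t\<bar> / u * (1 / real n)"
        by (simp only: integral_mult_right_zero e2)
      finally show "expectation (\<lambda>\<omega>. min (6 * (Z n i \<omega> / u)\<^sup>2) (\<bar>t\<bar> * \<bar>Z n i \<omega> / u\<bar> ^ 3))
          \<le> \<bar>t\<bar> / u * (1 / real n)" .
      qed simp
      also have "t\<^sup>2 / 6 * (\<bar>t\<bar> / u * (1 / real n)) = \<bar>t\<bar> ^ 3 / 6 / u / real n"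
        by (simp add: power3_eq_cube power2_eq_square)
      finally show ?thesis by (simp add: mult_ac)
    qed
    have "complex_of_real ((1 + (-(t\<^sup>2) / 2) / real n) ^ n) = (\<Prod>i<n. complex_of_real (1 + (-(t\<^sup>2) / 2) / real n))"
      by simp
    then have "cmod (\<phi> n - complex_of_real ((1 + (-(t\<^sup>2) / 2) / real n) ^ n)) =
        cmod ((\<Prod>i<n. char (distr M borel (\<lambda>\<omega>. Z n i \<omega> / u)) t) - (\<Prod>i<n. complex_of_real (1 + (-(t\<^sup>2) / 2) / real n)))"
      by (simp only: eq)
    also have "\<dots> \<le> (\<Sum>i<n. cmod (char (distr M borel (\<lambda>\<omega>. Z n i \<omega> / u)) t - complex_of_real (1 + (-(t\<^sup>2) / 2) / real n)))"
    proof (rule norm_prod_diff)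
      fix i
      interpret D: real_distribution "distr M borel (\<lambda>\<omega>. Z n i \<omega> / u)"
        by (rule real_distribution_distr) measurable
      show "cmod (char (distr M borel (\<lambda>\<omega>. Z n i \<omega> / u)) t) \<le> 1" by (rule D.cmod_char_le_1)
      have "\<bar>1 + (-(t\<^sup>2) / 2) / real n\<bar> \<le> 1" using tn n0 by (auto simp: abs_le_iff field_simps)
      then show "cmod (complex_of_real (1 + (-(t\<^sup>2) / 2) / real n)) \<le> 1" by (simp only: norm_of_real)
    qed
    also have "\<dots> \<le> (\<Sum>i<n. \<bar>t\<bar> ^ 3 / 6 / u / real n)"
      by (intro sum_mono) (use one in simp)
    also have "\<dots> = \<bar>t\<bar> ^ 3 / 6 / u" using n0 by simp
    finally show ?case by (simp add: u_def)
  qed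
  have "filterlim (\<lambda>n. sqrt (real n * v n)) at_top sequentially"
    by (rule filterlim_compose[OF sqrt_at_top lim])
  then have z: "(\<lambda>n. \<bar>t\<bar> ^ 3 / 6 / sqrt (real n * v n)) \<longlonglongrightarrow> 0"
    by (intro tendsto_divide_0[OF tendsto_const] filterlim_at_top_imp_at_infinity)
  have "(\<lambda>n. complex_of_real ((1 + (-(t\<^sup>2) / 2) / real n) ^ n)) \<longlonglongrightarrow> complex_of_real (exp (-(t\<^sup>2) / 2))"
    by (rule isCont_tendsto_compose [OF _ tendsto_exp_limit_sequentially]) auto
  then have "\<phi> \<longlonglongrightarrow> complex_of_real (exp (-(t\<^sup>2) / 2))"
    by (rule Lim_transform) (rule Lim_null_comparison [OF main z])
  then show ?thesis by (simp add: \<phi>_def[abs_def] char_std_normal_distribution)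
qed

text \<open>Second-order Taylor bound for \<open>t\<^sup>m\<close> on the unit interval, with the dependence on \<open>m\<close> explicit. The
recursion \<open>D (m + 1) = g D m + m p ^ (m - 1) (g - p)\<^sup>2\<close> for the remainder avoids derivatives.\<close>

lemma power_linearization:
  fixes g p :: real
  assumes "0 \<le> g" "g \<le> 1" "0 \<le> p" "p \<le> 1"
  shows "\<bar>g ^ m - p ^ m - real m * p ^ (m - 1) * (g - p)\<bar> \<le> (real m)\<^sup>2 * (g - p)\<^sup>2"
proof (induction m)
  case 0 then show ?case by simp
next
  case (Suc m)
  let ?D = "\<lambda>m. g ^ m - p ^ m - real m * p ^ (m - 1) * (g - p)"
  have rec: "?D (Suc m) = g * ?D m + real m * p ^ (m - 1) * (g - p)\<^sup>2"
    by (cases m) (auto simp: algebra_simps power2_eq_square)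
  have "\<bar>?D (Suc m)\<bar> \<le> \<bar>g * ?D m\<bar> + \<bar>real m * p ^ (m - 1) * (g - p)\<^sup>2\<bar>"
    unfolding rec by (rule abs_triangle_ineq)
  also have "\<bar>g * ?D m\<bar> \<le> 1 * \<bar>?D m\<bar>"
    unfolding abs_mult by (intro mult_right_mono) (use assms in auto)
  also have "\<bar>real m * p ^ (m - 1) * (g - p)\<^sup>2\<bar> \<le> real m * 1 * (g - p)\<^sup>2"
  proof -
    have "p ^ (m - 1) \<le> 1" by (intro power_le_one assms)
    then have "real m * p ^ (m - 1) * (g - p)\<^sup>2 \<le> real m * 1 * (g - p)\<^sup>2"
      by (intro mult_right_mono mult_left_mono) auto
    then show ?thesis using assms by (simp add: abs_mult)
  qed
  also have "1 * \<bar>?D m\<bar> + real m * 1 * (g - p)\<^sup>2 \<le> (real m)\<^sup>2 * (g - p)\<^sup>2 + real m * (g - p)\<^sup>2"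
    using Suc.IH by simp
  also have "\<dots> \<le> (real (Suc m))\<^sup>2 * (g - p)\<^sup>2"
  proof -
    have "((real m)\<^sup>2 + real m) * (g - p)\<^sup>2 \<le> (real (Suc m))\<^sup>2 * (g - p)\<^sup>2"
      by (rule mult_right_mono) (simp_all add: power2_eq_square distrib_left distrib_right)
    then show ?thesis by (simp only: distrib_right)
  qed
  finally show ?case by simp
qed

text \<open>Slutsky's lemma in quantitative form: \<open>exp (i t x)\<close> is Lipschitz in \<open>x\<close> with constant \<open>\<bar>t\<bar>\<close>, hence
perturbations that are small in mean do not change limits of characteristic functions.\<close>

lemma (in prob_space) char_diff_le:
  fixes A B :: "'a \<Rightarrow> real"
  assumes [measurable]: "A \<in> borel_measurable M" "B \<in> borel_measurable M"
    and int: "integrable M (\<lambda>\<omega>. A \<omega> - B \<omega>)"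
  shows "cmod (char (distr M borel A) t - char (distr M borel B) t) \<le> \<bar>t\<bar> * expectation (\<lambda>\<omega>. \<bar>A \<omega> - B \<omega>\<bar>)"
proof -
  have i: "integrable M (\<lambda>\<omega>. iexp (t * A \<omega>))" "integrable M (\<lambda>\<omega>. iexp (t * B \<omega>))"
    by (rule integrable_iexp; simp)+
  have "char (distr M borel A) t - char (distr M borel B) t = (CLINT \<omega>|M. iexp (t * A \<omega>) - iexp (t * B \<omega>))"
    using i by (simp add: char_def integral_distr)
  also have "cmod \<dots> \<le> expectation (\<lambda>\<omega>. cmod (iexp (t * A \<omega>) - iexp (t * B \<omega>)))"
    by (rule integral_norm_bound)
  also have "\<dots> \<le> expectation (\<lambda>\<omega>. \<bar>t\<bar> * \<bar>A \<omega> - B \<omega>\<bar>)"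
  proof (rule integral_mono)
    show "integrable M (\<lambda>\<omega>. cmod (iexp (t * A \<omega>) - iexp (t * B \<omega>)))"
      using i by (intro integrable_norm Bochner_Integration.integrable_diff)
    show "integrable M (\<lambda>\<omega>. \<bar>t\<bar> * \<bar>A \<omega> - B \<omega>\<bar>)" using int by simp
    fix \<omega>
    have "iexp (t * A \<omega>) - iexp (t * B \<omega>) = iexp (t * B \<omega>) * (iexp (t * (A \<omega> - B \<omega>)) - 1)"
      by (simp add: algebra_simps flip: exp_add)
    then have "cmod (iexp (t * A \<omega>) - iexp (t * B \<omega>)) = cmod (iexp (t * (A \<omega> - B \<omega>)) - 1)"
      by (simp add: norm_mult del: of_real_mult of_real_diff)
    also have "\<dots> \<le> \<bar>t * (A \<omega> - B \<omega>)\<bar>"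
      using iexp_approx1[of "t * (A \<omega> - B \<omega>)" 0] by simp
    finally show "cmod (iexp (t * A \<omega>) - iexp (t * B \<omega>)) \<le> \<bar>t\<bar> * \<bar>A \<omega> - B \<omega>\<bar>"
      by (simp add: abs_mult)
  qed
  finally show ?thesis by simp
qed

section \<open>Powers of sample means\<close>

text \<open>The delta method for \<open>t\<^sup>m\<close> at a fixed sample size. Here \<open>G\<close> is the sample mean with expectation \<open>p\<close>,
\<open>V\<close> the standardized value of \<open>p - G\<close>, \<open>s\<close> the standard deviation of the linear part of \<open>G\<^sup>m\<close>, and
\<open>(c - p\<^sup>m) / s\<close> the standardized bias. Linearization gives \<open>(c - G\<^sup>m) / s = (c - p\<^sup>m) / s + V + R\<close> with
\<open>\<bar>R\<bar> \<le> \<epsilon> V\<^sup>2\<close>. As \<open>V\<close> is centred with unit variance, \<open>1 + ((c - p\<^sup>m) / s)\<^sup>2\<close> is the second moment of bias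
plus \<open>V\<close>, which is compared with the mean squared error of \<open>G\<^sup>m\<close>: a mean squared error close to
\<open>s\<^sup>2\<close> leaves no room for a bias.\<close>

lemma (in prob_space) power_of_mean_delta:
  fixes Z :: "nat \<Rightarrow> 'a \<Rightarrow> real" and n m :: nat and p c v :: real
  assumes indep: "indep_vars (\<lambda>_. borel) Z UNIV"
    and bd: "\<And>i \<omega>. \<bar>Z i \<omega>\<bar> \<le> 1"
    and mean: "\<And>i. expectation (Z i) = 0"
    and var: "\<And>i. expectation (\<lambda>\<omega>. (Z i \<omega>)\<^sup>2) = v"
    and n0: "n > 0" and m0: "m > 0" and p: "0 < p" "p \<le> 1" and nv: "real n * v \<ge> 1"
  defines "G \<equiv> \<lambda>\<omega>. p - (\<Sum>i<n. Z i \<omega>) / real n"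
    and "V \<equiv> \<lambda>\<omega>. (\<Sum>i<n. Z i \<omega>) / sqrt (real n * v)"
    and "s \<equiv> real m * p ^ (m - 1) * sqrt (v / real n)"
    and "\<epsilon> \<equiv> real m * sqrt (v / real n) / p ^ (m - 1)"
  assumes G01: "\<And>\<omega>. 0 \<le> G \<omega> \<and> G \<omega> \<le> 1"
  shows "((c - p ^ m) / s)\<^sup>2 \<le> (1 + \<epsilon>) * expectation (\<lambda>\<omega>. ((c - G \<omega> ^ m) / s)\<^sup>2) + 4 * \<epsilon>\<^sup>2 + 4 * \<epsilon> - 1"
    and "cmod (char (distr M borel (\<lambda>\<omega>. (c - G \<omega> ^ m - b) / s)) t - char (distr M borel V) t)
        \<le> \<bar>t\<bar> * (\<epsilon> + \<bar>(c - p ^ m) / s\<bar> + \<bar>b\<bar> / s)"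
proof -
  have rv [measurable]: "Z i \<in> borel_measurable M" for i
    using indep unfolding indep_vars_def2 by simp
  have [measurable]: "G \<in> borel_measurable M" "V \<in> borel_measurable M"
    unfolding G_def V_def by measurable
  define a where "a = sqrt (v / real n)"
  have v0: "v > 0" using nv n0 by (smt (verit) mult_nonneg_nonpos of_nat_0_le_iff)
  have a0: "a > 0" using v0 n0 by (simp add: a_def)
  have s_eq: "s = real m * p ^ (m - 1) * a" and e_eq: "\<epsilon> = real m * a / p ^ (m - 1)"
    by (simp_all add: s_def \<epsilon>_def a_def)
  have s0: "s > 0" and e0: "\<epsilon> > 0" using m0 p a0 by (simp_all add: s_eq e_eq)
  have se: "s * \<epsilon> = (real m)\<^sup>2 * a\<^sup>2" using p by (simp add: s_eq e_eq power2_eq_square)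
  define d where "d = (c - p ^ m) / s"
  define T where "T \<omega> = (c - G \<omega> ^ m) / s" for \<omega>
  define R where "R \<omega> = T \<omega> - d - V \<omega>" for \<omega>
  have [measurable]: "T \<in> borel_measurable M" "R \<in> borel_measurable M"
    unfolding T_def R_def by measurable
  have aV: "a * V \<omega> = p - G \<omega>" for \<omega>
  proof -
    have "a * sqrt (real n * v) = v" using n0 v0
      by (simp add: a_def real_sqrt_divide real_sqrt_mult)
    then have "a = v / sqrt (real n * v)"
      using n0 v0 by (simp add: eq_divide_eq)
    then have "a / sqrt (real n * v) = v / (sqrt (real n * v) * sqrt (real n * v))"
      by simp
    also have "\<dots> = v / (real n * v)" using n0 v0 by simp
    finally have "a / sqrt (real n * v) = 1 / real n" using v0 by simp
    moreover have "a * V \<omega> = (a / sqrt (real n * v)) * (\<Sum>i<n. Z i \<omega>)" by (simp add: V_def)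
    ultimately show ?thesis by (simp add: G_def)
  qed
  have R_le: "\<bar>R \<omega>\<bar> \<le> \<epsilon> * (V \<omega>)\<^sup>2" for \<omega>
  proof -
    have sR: "s * R \<omega> = - (G \<omega> ^ m - p ^ m - real m * p ^ (m - 1) * (G \<omega> - p))"
    proof -
      have "s * R \<omega> = (c - G \<omega> ^ m) - (c - p ^ m) - real m * p ^ (m - 1) * (a * V \<omega>)"
      proof -
        have "s * T \<omega> = c - G \<omega> ^ m" "s * d = c - p ^ m" using s0 by (simp_all add: T_def d_def)
        moreover have "s * V \<omega> = real m * p ^ (m - 1) * (a * V \<omega>)" by (simp add: s_eq)
        ultimately show ?thesis by (simp only: R_def right_diff_distrib)
      qed
      then show ?thesis unfolding aV by (simp add: algebra_simps)
    qed
    have "s * \<bar>R \<omega>\<bar> = \<bar>s * R \<omega>\<bar>" using s0 by (simp add: abs_mult)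
    also have "\<dots> \<le> (real m)\<^sup>2 * (G \<omega> - p)\<^sup>2"
      unfolding sR abs_minus_cancel by (rule power_linearization) (use G01 p in auto)
    also have "(G \<omega> - p)\<^sup>2 = (a * V \<omega>)\<^sup>2" unfolding aV by (rule power2_commute)
    also have "(real m)\<^sup>2 * (a * V \<omega>)\<^sup>2 = s * (\<epsilon> * (V \<omega>)\<^sup>2)"
      unfolding mult.assoc[symmetric] se by (simp add: power_mult_distrib)
    finally show ?thesis using s0 by simp
  qed
  have V_bd: "\<bar>V \<omega>\<bar> \<le> real n / sqrt (real n * v)" for \<omega>
  proof -
    have "\<bar>\<Sum>i<n. Z i \<omega>\<bar> \<le> (\<Sum>i<n. \<bar>Z i \<omega>\<bar>)" by (rule sum_abs)
    also have "\<dots> \<le> (\<Sum>i<n. 1)" by (intro sum_mono bd)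
    finally have "\<bar>\<Sum>i<n. Z i \<omega>\<bar> \<le> real n" by simp
    then show ?thesis using v0 n0 by (simp add: V_def divide_right_mono)
  qed
  have intV: "integrable M (\<lambda>\<omega>. V \<omega> ^ k)" for k
  proof (rule integrable_const_bound[where B = "(real n / sqrt (real n * v)) ^ k"])
    show "AE \<omega> in M. norm (V \<omega> ^ k) \<le> (real n / sqrt (real n * v)) ^ k"
      by (rule AE_I2) (simp add: power_abs V_bd power_mono del: power_divide)
  qed measurable
  have intT: "integrable M (\<lambda>\<omega>. T \<omega> ^ k)" for k
  proof (rule integrable_const_bound[where B = "((\<bar>c\<bar> + 1) / s) ^ k"])
    have "\<bar>T \<omega>\<bar> \<le> (\<bar>c\<bar> + 1) / s" for \<omega>
    proof -
      have "0 \<le> G \<omega> ^ m" "G \<omega> ^ m \<le> 1" using G01 by (auto intro: power_le_one)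
      then show ?thesis using s0 by (auto simp: T_def abs_divide intro!: divide_right_mono)
    qed
    then show "AE \<omega> in M. norm (T \<omega> ^ k) \<le> ((\<bar>c\<bar> + 1) / s) ^ k"
      by (intro AE_I2) (simp add: power_abs power_mono del: power_divide)
  qed measurable
  have EV: "expectation V = 0" and EV2: "expectation (\<lambda>\<omega>. (V \<omega>)\<^sup>2) = 1"
    and EV4: "expectation (\<lambda>\<omega>. V \<omega> ^ 4) \<le> 4"
  proof -
    note mom = centred_sum_moments[OF indep bd mean var, of n]
    let ?N = "real n * v"
    have N: "?N > 0" using nv by linarith
    show "expectation V = 0" using mom(1) by (simp add: V_def)
    show "expectation (\<lambda>\<omega>. (V \<omega>)\<^sup>2) = 1" using mom(2) N v0 n0 by (simp add: V_def power_divide)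
    have q: "sqrt ?N ^ 4 = ?N\<^sup>2"
      using N by (metis (no_types) less_eq_real_def mult_2 numeral_Bit0 power_even_eq power_mult real_sqrt_pow2)
    have "expectation (\<lambda>\<omega>. V \<omega> ^ 4) = expectation (\<lambda>\<omega>. (\<Sum>i<n. Z i \<omega>) ^ 4) / ?N\<^sup>2"
      unfolding V_def power_divide q by simp
    also have "\<dots> \<le> (?N + 3 * ?N\<^sup>2) / ?N\<^sup>2" by (intro divide_right_mono mom(3)) simp
    also have "\<dots> \<le> 4" 
    proof -
      have "?N \<le> ?N\<^sup>2" using mult_left_mono[OF nv, of ?N] N by (simp add: power2_eq_square)
      then show ?thesis using N v0 n0 by (simp add: divide_le_eq)
    qed
    finally show "expectation (\<lambda>\<omega>. V \<omega> ^ 4) \<le> 4" .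
  qed
  have intV': "integrable M V" "integrable M (\<lambda>\<omega>. (V \<omega>)\<^sup>2)" using intV[of 1] intV[of 2] by simp_all
  have "d\<^sup>2 + 1 = expectation (\<lambda>\<omega>. d\<^sup>2 + 2 * d * V \<omega> + (V \<omega>)\<^sup>2)"
    using intV' by (simp add: EV EV2 prob_space)
  also have "\<dots> \<le> expectation (\<lambda>\<omega>. (1 + \<epsilon>) * (T \<omega>)\<^sup>2 + (\<epsilon>\<^sup>2 + \<epsilon>) * V \<omega> ^ 4)"
  proof (rule integral_mono)
    show "integrable M (\<lambda>\<omega>. d\<^sup>2 + 2 * d * V \<omega> + (V \<omega>)\<^sup>2)" using intV' by simp
    show "integrable M (\<lambda>\<omega>. (1 + \<epsilon>) * (T \<omega>)\<^sup>2 + (\<epsilon>\<^sup>2 + \<epsilon>) * V \<omega> ^ 4)"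
      using intV[of 4] intT[of 2] by simp
    fix \<omega>
    have eq: "d\<^sup>2 + 2 * d * V \<omega> + (V \<omega>)\<^sup>2 = (T \<omega> - R \<omega>)\<^sup>2"
      by (simp add: R_def power2_eq_square algebra_simps)
    \<comment> \<open>Young's inequality with weight \<open>\<epsilon>\<close>, chosen so that \<open>(1 + 1 / \<epsilon>) R\<^sup>2\<close> is still of order \<open>\<epsilon>\<close>\<close>
    have "\<epsilon> * ((1 + \<epsilon>) * (T \<omega>)\<^sup>2 + (1 + 1 / \<epsilon>) * (R \<omega>)\<^sup>2 - (T \<omega> - R \<omega>)\<^sup>2) = (\<epsilon> * T \<omega> + R \<omega>)\<^sup>2"
      using e0 by (simp add: power2_eq_square field_simps)
    then have "0 \<le> \<epsilon> * ((1 + \<epsilon>) * (T \<omega>)\<^sup>2 + (1 + 1 / \<epsilon>) * (R \<omega>)\<^sup>2 - (T \<omega> - R \<omega>)\<^sup>2)"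
      by (metis zero_le_power2)
    then have young: "(T \<omega> - R \<omega>)\<^sup>2 \<le> (1 + \<epsilon>) * (T \<omega>)\<^sup>2 + (1 + 1 / \<epsilon>) * (R \<omega>)\<^sup>2"
      using e0 by (simp add: zero_le_mult_iff)
    have "(R \<omega>)\<^sup>2 \<le> (\<epsilon> * (V \<omega>)\<^sup>2)\<^sup>2"
      using R_le[of \<omega>] by (metis abs_ge_zero power2_abs power_mono)
    also have "\<dots> = \<epsilon>\<^sup>2 * V \<omega> ^ 4" by (simp add: power_mult_distrib)
    finally have "(1 + 1 / \<epsilon>) * (R \<omega>)\<^sup>2 \<le> (1 + 1 / \<epsilon>) * (\<epsilon>\<^sup>2 * V \<omega> ^ 4)"
      using e0 by (intro mult_left_mono) auto
    also have "\<dots> = (\<epsilon>\<^sup>2 + \<epsilon>) * V \<omega> ^ 4" using e0 by (simp add: power2_eq_square field_simps)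
    finally show "d\<^sup>2 + 2 * d * V \<omega> + (V \<omega>)\<^sup>2 \<le> (1 + \<epsilon>) * (T \<omega>)\<^sup>2 + (\<epsilon>\<^sup>2 + \<epsilon>) * V \<omega> ^ 4"
      unfolding eq using young by linarith
  qed
  also have "\<dots> = (1 + \<epsilon>) * expectation (\<lambda>\<omega>. (T \<omega>)\<^sup>2) + (\<epsilon>\<^sup>2 + \<epsilon>) * expectation (\<lambda>\<omega>. V \<omega> ^ 4)"
    using intV[of 4] intT[of 2] by simp
  also have "\<dots> \<le> (1 + \<epsilon>) * expectation (\<lambda>\<omega>. (T \<omega>)\<^sup>2) + (\<epsilon>\<^sup>2 + \<epsilon>) * 4"
    using e0 EV4 by (intro add_left_mono mult_left_mono) auto
  finally show "((c - p ^ m) / s)\<^sup>2 \<le> (1 + \<epsilon>) * expectation (\<lambda>\<omega>. ((c - G \<omega> ^ m) / s)\<^sup>2) + 4 * \<epsilon>\<^sup>2 + 4 * \<epsilon> - 1"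
    by (simp add: d_def T_def algebra_simps)
  let ?A = "\<lambda>\<omega>. (c - G \<omega> ^ m - b) / s"
  have A: "?A \<omega> = T \<omega> - b / s" for \<omega> by (simp add: T_def diff_divide_distrib)
  have int: "integrable M (\<lambda>\<omega>. ?A \<omega> - V \<omega>)"
    unfolding A using intT[of 1] intV' by simp
  have "cmod (char (distr M borel ?A) t - char (distr M borel V) t) \<le> \<bar>t\<bar> * expectation (\<lambda>\<omega>. \<bar>?A \<omega> - V \<omega>\<bar>)"
    by (rule char_diff_le[OF _ _ int]) measurable
  also have "\<dots> \<le> \<bar>t\<bar> * (\<epsilon> + \<bar>d\<bar> + \<bar>b\<bar> / s)"
  proof (rule mult_left_mono)
    have "expectation (\<lambda>\<omega>. \<bar>?A \<omega> - V \<omega>\<bar>) \<le> expectation (\<lambda>\<omega>. \<epsilon> * (V \<omega>)\<^sup>2 + (\<bar>d\<bar> + \<bar>b\<bar> / s))"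
    proof (rule integral_mono)
      show "integrable M (\<lambda>\<omega>. \<bar>?A \<omega> - V \<omega>\<bar>)" by (rule integrable_abs[OF int])
      show "integrable M (\<lambda>\<omega>. \<epsilon> * (V \<omega>)\<^sup>2 + (\<bar>d\<bar> + \<bar>b\<bar> / s))" using intV' by simp
      fix \<omega>
      have "?A \<omega> - V \<omega> = R \<omega> + d - b / s" by (simp add: A R_def)
      also have "\<bar>\<dots>\<bar> \<le> \<bar>R \<omega>\<bar> + \<bar>d\<bar> + \<bar>b / s\<bar>" by linarith
      finally show "\<bar>?A \<omega> - V \<omega>\<bar> \<le> \<epsilon> * (V \<omega>)\<^sup>2 + (\<bar>d\<bar> + \<bar>b\<bar> / s)"
        using R_le[of \<omega>] s0 by (simp add: abs_divide)
    qed
    also have "\<dots> = \<epsilon> + (\<bar>d\<bar> + \<bar>b\<bar> / s)" using intV' EV2 by (simp add: prob_space)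
    finally show "expectation (\<lambda>\<omega>. \<bar>?A \<omega> - V \<omega>\<bar>) \<le> \<epsilon> + \<bar>d\<bar> + \<bar>b\<bar> / s" by simp
  qed simp
  finally show "cmod (char (distr M borel ?A) t - char (distr M borel V) t)
        \<le> \<bar>t\<bar> * (\<epsilon> + \<bar>(c - p ^ m) / s\<bar> + \<bar>b\<bar> / s)"
    by (simp add: d_def)
qed

text \<open>The probabilistic core. The sample means \<open>G n\<close> of \<open>[0,1]\<close>-valued variables with mean \<open>1 - q n\<close> are
raised to the power \<open>m n\<close>, and the mean squared error about \<open>c n\<close> is, to leading order, the variance
of \<open>G n ^ m n\<close> that one would have if \<open>m q \<rightarrow> \<delta>\<close> and \<open>m v \<rightarrow> \<delta>\<close>, where \<open>v\<close> is the variance of a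
summand. Both limits are forced. The vanishing mean squared error makes
\<open>E (G n ^ m n)\<close> converge to \<open>exp (- \<delta>)\<close>; since \<open>m (1 - G n)\<close> concentrates around \<open>m q\<close>, an unbounded
\<open>m q\<close> would make this expectation too small; and for bounded \<open>m q\<close> it differs from \<open>(1 - q) ^ m\<close> by a
null sequence. For \<open>v\<close> the upper bound is \<open>v \<le> q\<close> and the lower bound the hypothesis on \<open>r\<close>.
The scale \<open>s\<close> is then of order \<open>sqrt (m / n)\<close>, the standardized bias tends to \<open>0\<close>, and
every centring \<open>b\<close> of smaller order than \<open>sqrt (m / n)\<close> is admissible.\<close>

theorem (in prob_space) power_of_mean_asymptotic_normality:
  fixes Y :: "nat \<Rightarrow> nat \<Rightarrow> 'a \<Rightarrow> real" and q r b c :: "nat \<Rightarrow> real" and m :: "nat \<Rightarrow> nat"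
  defines "G \<equiv> \<lambda>n \<omega>. (\<Sum>i<n. Y n i \<omega>) / real n"
  assumes indep: "\<And>n. indep_vars (\<lambda>_. borel) (Y n) UNIV"
    and Y01: "\<And>n i \<omega>. 0 \<le> Y n i \<omega> \<and> Y n i \<omega> \<le> 1"
    and mean: "\<And>n i. expectation (Y n i) = 1 - q n"
    and second: "\<And>n i. expectation (\<lambda>\<omega>. (1 - Y n i \<omega>)\<^sup>2) = r n"
    and m_inf: "filterlim m at_top sequentially"
    and mn: "(\<lambda>n. real (m n) / real n) \<longlonglongrightarrow> 0"
    and \<delta>: "\<delta> > 0"
    and c: "c \<longlonglongrightarrow> exp (- \<delta>)"
    and lower: "\<And>\<eta>. \<eta> > 0 \<Longrightarrow> \<forall>\<^sub>F n in sequentially. \<delta> - \<eta> \<le> real (m n) * r n"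
    and mse: "(\<lambda>n. real n / real (m n) * expectation (\<lambda>\<omega>. (c n - G n \<omega> ^ m n)\<^sup>2)) \<longlonglongrightarrow> \<delta> * exp (- 2 * \<delta>)"
    and b: "(\<lambda>n. b n / sqrt (real (m n) / real n)) \<longlonglongrightarrow> 0"
  shows "\<exists>s. (\<forall>n. s n > 0) \<and>
    weak_conv_m (\<lambda>n. distr M borel (\<lambda>\<omega>. (c n - G n \<omega> ^ m n - b n) / s n)) std_normal_distribution"
proof -
  have [measurable]: "Y n i \<in> borel_measurable M" for n i
    using indep[of n] unfolding indep_vars_def2 by simp
  have Gm [measurable]: "G n \<in> borel_measurable M" for n unfolding G_def by measurable
  have intY: "integrable M (Y n i)" for n i
    by (rule integrable_const_bound[where B = 1]) (use Y01 in auto)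
  have intY2: "integrable M (\<lambda>\<omega>. (1 - Y n i \<omega>)\<^sup>2)" for n i
    by (rule integrable_const_bound[where B = 1]) (use Y01 in \<open>auto simp: abs_square_le_1 abs_le_iff\<close>)
  have q01: "0 \<le> q n" "q n \<le> 1" for n
  proof -
    have "expectation (Y n 0) \<le> expectation (\<lambda>_. 1)" by (rule integral_mono) (use intY Y01 in auto)
    then show "0 \<le> q n" using mean[of n 0] by (simp add: prob_space)
    have "0 \<le> expectation (Y n 0)" by (rule Bochner_Integration.integral_nonneg) (use Y01 in auto)
    then show "q n \<le> 1" using mean[of n 0] by simp
  qed
  have r_le: "r n \<le> q n" for n
  proof -
    have "expectation (\<lambda>\<omega>. (1 - Y n 0 \<omega>)\<^sup>2) \<le> expectation (\<lambda>\<omega>. 1 - Y n 0 \<omega>)"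
    proof (rule integral_mono[OF intY2])
      show "integrable M (\<lambda>\<omega>. 1 - Y n 0 \<omega>)" using intY by simp
      fix \<omega> show "(1 - Y n 0 \<omega>)\<^sup>2 \<le> 1 - Y n 0 \<omega>"
        using mult_left_mono[of "1 - Y n 0 \<omega>" 1 "1 - Y n 0 \<omega>"] Y01[of n 0 \<omega>]
        by (simp add: power2_eq_square)
    qed
    also have "expectation (\<lambda>\<omega>. 1 - Y n 0 \<omega>) = q n" using intY mean by (simp add: prob_space)
    finally show ?thesis using second by simp
  qed
  define v where "v n = r n - (q n)\<^sup>2" for n
  define Z where "Z n i \<omega> = (1 - q n) - Y n i \<omega>" for n i \<omega>
  have Z_indep: "indep_vars (\<lambda>_. borel) (Z n) UNIV" for n
    unfolding Z_def[abs_def] by (rule indep_vars_compose2[OF indep]) auto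
  have Z_bd: "\<bar>Z n i \<omega>\<bar> \<le> 1" for n i \<omega> using Y01[of n i \<omega>] q01[of n] by (auto simp: Z_def)
  have Z_mean: "expectation (Z n i) = 0" for n i
    unfolding Z_def[abs_def] using intY mean by (simp add: prob_space)
  have Z_var: "expectation (\<lambda>\<omega>. (Z n i \<omega>)\<^sup>2) = v n" for n i
  proof -
    have "expectation (\<lambda>\<omega>. (Z n i \<omega>)\<^sup>2) = expectation (\<lambda>\<omega>. (1 - Y n i \<omega>)\<^sup>2 - 2 * q n * (1 - Y n i \<omega>) + (q n)\<^sup>2)"
      by (intro Bochner_Integration.integral_cong) (auto simp: Z_def power2_eq_square algebra_simps)
    also have "\<dots> = r n - 2 * q n * (1 - (1 - q n)) + (q n)\<^sup>2"
      using intY[of n i] intY2[of n i] mean[of n i] second[of n i] by (simp add: prob_space)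
    finally show ?thesis by (simp add: v_def power2_eq_square)
  qed
  have v_le: "v n \<le> q n" for n using r_le[of n] by (simp add: v_def) (smt (verit) zero_le_power2)
  note mom = centred_sum_moments[OF Z_indep Z_bd Z_mean Z_var]
  have G_eq: "G n \<omega> = (1 - q n) - (\<Sum>i<n. Z n i \<omega>) / real n" if "n > 0" for n \<omega>
    using that by (simp add: G_def Z_def sum_subtractf diff_divide_distrib)
  have G01: "0 \<le> G n \<omega>" "G n \<omega> \<le> 1" for n \<omega>
  proof -
    show "0 \<le> G n \<omega>" using Y01 by (auto simp: G_def intro!: divide_nonneg_nonneg sum_nonneg)
    have "(\<Sum>i<n. Y n i \<omega>) \<le> (\<Sum>i<n. 1)" by (intro sum_mono) (use Y01 in auto)
    then show "G n \<omega> \<le> 1" by (cases "n = 0") (auto simp: G_def divide_le_eq)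
  qed
  have Gp01: "0 \<le> G n \<omega> ^ k" "G n \<omega> ^ k \<le> 1" for n \<omega> k
    using G01[of n \<omega>] by (auto intro: power_le_one)
  have intG: "integrable M (\<lambda>\<omega>. G n \<omega> ^ k)" for n k
    by (rule integrable_const_bound[where B = 1]) (use Gp01 in auto)
  have intGd: "integrable M (\<lambda>\<omega>. (a - G n \<omega> ^ k)\<^sup>2)" for n k a
  proof (rule integrable_const_bound[where B = "(\<bar>a\<bar> + 1)\<^sup>2"])
    have "(a - G n \<omega> ^ k)\<^sup>2 \<le> (\<bar>a\<bar> + 1)\<^sup>2" for \<omega>
      using Gp01[of n \<omega> k] by (intro power2_le_iff_abs_le[THEN iffD2]) auto
    then show "AE \<omega> in M. norm ((a - G n \<omega> ^ k)\<^sup>2) \<le> (\<bar>a\<bar> + 1)\<^sup>2" by (intro AE_I2) simp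
  qed measurable
  have EG2: "expectation (\<lambda>\<omega>. (1 - q n - G n \<omega>)\<^sup>2) = v n / real n" if "n > 0" for n
  proof -
    have "expectation (\<lambda>\<omega>. (1 - q n - G n \<omega>)\<^sup>2) = expectation (\<lambda>\<omega>. (\<Sum>i<n. Z n i \<omega>)\<^sup>2) / (real n)\<^sup>2"
      unfolding G_eq[OF that] by (simp add: power_divide)
    then show ?thesis using mom(2)[of n n] that by (simp add: power2_eq_square)
  qed
  have sq_mean: "(a - expectation (\<lambda>\<omega>. G n \<omega> ^ k))\<^sup>2 \<le> expectation (\<lambda>\<omega>. (a - G n \<omega> ^ k)\<^sup>2)" for a n k
  proof -
    let ?A = "\<lambda>\<omega>. a - G n \<omega> ^ k"
    have iA: "integrable M ?A" using intG by simp
    have "0 \<le> variance ?A" by (rule variance_positive)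
    also have "variance ?A = expectation (\<lambda>\<omega>. (?A \<omega>)\<^sup>2) - (expectation ?A)\<^sup>2"
      by (rule variance_eq[OF iA intGd])
    also have "expectation ?A = a - expectation (\<lambda>\<omega>. G n \<omega> ^ k)" using intG by (simp add: prob_space)
    finally show ?thesis by simp
  qed
  have m_inf': "filterlim (\<lambda>n. real (m n)) at_top sequentially"
    by (rule filterlim_compose[OF filterlim_real_sequentially m_inf])
  have ev_m: "\<forall>\<^sub>F n in sequentially. m n > 0" 
    by (rule eventually_compose_filterlim[OF eventually_gt_at_top m_inf])
  have ev_n: "\<forall>\<^sub>F n in sequentially. n > (0::nat)" by (rule eventually_gt_at_top)

  have sq0: "f \<longlonglongrightarrow> 0" if "(\<lambda>n. (f n)\<^sup>2) \<longlonglongrightarrow> 0" for f :: "nat \<Rightarrow> real"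
    using tendsto_real_sqrt[OF that] by (simp add: tendsto_rabs_zero_iff)

  define e where "e n = expectation (\<lambda>\<omega>. G n \<omega> ^ m n)" for n
  have e_lim: "e \<longlonglongrightarrow> exp (- \<delta>)"
  proof -
    have "(\<lambda>n. real (m n) / real n * (real n / real (m n) * expectation (\<lambda>\<omega>. (c n - G n \<omega> ^ m n)\<^sup>2))) \<longlonglongrightarrow> 0 * (\<delta> * exp (- 2 * \<delta>))"
      by (intro tendsto_mult mn mse)
    moreover have "\<forall>\<^sub>F n in sequentially. real (m n) / real n * (real n / real (m n) * expectation (\<lambda>\<omega>. (c n - G n \<omega> ^ m n)\<^sup>2)) = expectation (\<lambda>\<omega>. (c n - G n \<omega> ^ m n)\<^sup>2)"
      using ev_m ev_n by eventually_elim simp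
    ultimately have "(\<lambda>n. expectation (\<lambda>\<omega>. (c n - G n \<omega> ^ m n)\<^sup>2)) \<longlonglongrightarrow> 0"
      by (simp add: tendsto_cong)
    then have "(\<lambda>n. (c n - e n)\<^sup>2) \<longlonglongrightarrow> 0"
      by (rule Lim_null_comparison[rotated]) (use sq_mean in \<open>auto simp: e_def\<close>)
    then have "(\<lambda>n. c n - e n) \<longlonglongrightarrow> 0" by (rule sq0)
    from tendsto_diff[OF c this] show ?thesis by simp
  qed

  define B where "B n = real (m n) * q n" for n
  have B0: "B n \<ge> 0" for n using q01 by (simp add: B_def)
  \<comment> \<open>Either \<open>m (1 - G)\<close> is at least half its mean \<open>B\<close>, or Chebyshev's bound applies\<close>
  have e_le: "e n \<le> exp (- B n / 2) + 4 * (real (m n) / real n) / B n" if "n > 0" "B n > 0" for n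
  proof -
    let ?L = "\<lambda>\<omega>. real (m n) * (1 - G n \<omega>)"
    have m0: "real (m n) > 0" using that q01[of n] by (auto simp: B_def zero_less_mult_iff)
    have int2: "integrable M (\<lambda>\<omega>. (1 - q n - G n \<omega>)\<^sup>2)" using intGd[of "1 - q n" n 1] by simp
    have "e n \<le> expectation (\<lambda>\<omega>. exp (- B n / 2) + 4 / (B n)\<^sup>2 * ((real (m n))\<^sup>2 * (1 - q n - G n \<omega>)\<^sup>2))"
      unfolding e_def
    proof (rule integral_mono[OF intG])
      show "integrable M (\<lambda>\<omega>. exp (- B n / 2) + 4 / (B n)\<^sup>2 * ((real (m n))\<^sup>2 * (1 - q n - G n \<omega>)\<^sup>2))"
        using int2 by simp
      fix \<omega>
      have eq: "(real (m n))\<^sup>2 * (1 - q n - G n \<omega>)\<^sup>2 = (?L \<omega> - B n)\<^sup>2"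
        by (simp add: B_def algebra_simps flip: power_mult_distrib)
      show "G n \<omega> ^ m n \<le> exp (- B n / 2) + 4 / (B n)\<^sup>2 * ((real (m n))\<^sup>2 * (1 - q n - G n \<omega>)\<^sup>2)"
      proof (cases "?L \<omega> \<ge> B n / 2")
        case True
        have "G n \<omega> \<le> exp (- (1 - G n \<omega>))" using exp_ge_add_one_self[of "- (1 - G n \<omega>)"] by simp
        then have "G n \<omega> ^ m n \<le> exp (- (1 - G n \<omega>)) ^ m n" by (intro power_mono G01)
        also have "\<dots> = exp (- ?L \<omega>)" by (simp add: exp_of_nat_mult[symmetric] algebra_simps)
        also have "\<dots> \<le> exp (- B n / 2)" using True by simp
        finally show ?thesis by (simp add: add_increasing2)
      next
        case False
        then have "(B n / 2)\<^sup>2 \<le> (B n - ?L \<omega>)\<^sup>2" using that by (intro power_mono) auto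
        then have "(B n)\<^sup>2 \<le> 4 * (?L \<omega> - B n)\<^sup>2" by (simp add: power_divide power2_commute)
        then have "1 \<le> 4 / (B n)\<^sup>2 * (?L \<omega> - B n)\<^sup>2" using that by (simp add: field_simps)
        then show ?thesis unfolding eq using Gp01[of n \<omega> "m n"] by (smt (verit) exp_gt_zero)
      qed
    qed
    also have "\<dots> = exp (- B n / 2) + 4 / (B n)\<^sup>2 * ((real (m n))\<^sup>2 * (v n / real n))"
      using int2 EG2[OF that(1)] by (simp add: prob_space)
    also have "\<dots> \<le> exp (- B n / 2) + 4 / (B n)\<^sup>2 * ((real (m n))\<^sup>2 * (q n / real n))"
      by (intro add_left_mono mult_left_mono divide_right_mono v_le) auto
    also have "4 / (B n)\<^sup>2 * ((real (m n))\<^sup>2 * (q n / real n)) = 4 * (real (m n) / real n) / B n"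
      using that m0 by (simp add: B_def field_simps power2_eq_square)
    finally show ?thesis .
  qed
  \<comment> \<open>For \<open>B > K\<close> and small \<open>m / n\<close> the previous bound would make \<open>e\<close> smaller than \<open>exp (- \<delta>) / 2\<close>\<close>
  define K where "K = 2 * \<delta> + 2 * ln 4"
  have K1: "K > 1"
  proof -
    have "1 < ln (4::real)" by (rule exp_less_cancel_iff[THEN iffD1]) (use e_less_272 in simp)
    then show ?thesis using \<delta> by (simp add: K_def)
  qed
  have eK: "exp (- K / 2) = exp (- \<delta>) / 4"
  proof -
    have "- K / 2 = - \<delta> - ln 4" by (simp add: K_def)
    then show ?thesis by (simp add: exp_diff)
  qed
  have B_bd: "\<forall>\<^sub>F n in sequentially. B n \<le> K"
  proof -
    have "\<forall>\<^sub>F n in sequentially. e n > exp (- \<delta>) / 2"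
      by (rule order_tendstoD(1)[OF e_lim]) simp
    moreover have "\<forall>\<^sub>F n in sequentially. real (m n) / real n < exp (- \<delta>) / 16"
      by (rule order_tendstoD(2)[OF mn]) simp
    ultimately show ?thesis using ev_n
    proof eventually_elim
      case (elim n)
      show ?case
      proof (rule ccontr)
        assume "\<not> B n \<le> K"
        then have BK: "B n > K" by simp
        have "e n \<le> exp (- B n / 2) + 4 * (real (m n) / real n) / B n"
          by (rule e_le) (use BK K1 elim in auto)
        also have "exp (- B n / 2) \<le> exp (- K / 2)" using BK by simp
        also have "4 * (real (m n) / real n) / B n \<le> 4 * (real (m n) / real n)"
        proof -
          have "4 * (real (m n) / real n) / B n \<le> 4 * (real (m n) / real n) / 1"
            by (rule divide_left_mono) (use BK K1 in auto)
          then show ?thesis by simp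
        qed
        finally have "e n \<le> exp (- \<delta>) / 4 + 4 * (real (m n) / real n)" using eK by simp
        then show False using elim(1,2) by argo
      qed
    qed
  qed

  define p where "p n = 1 - q n" for n
  have p01: "0 \<le> p n" "p n \<le> 1" for n using q01 by (auto simp: p_def)
  have pm: "(\<lambda>n. p n ^ m n) \<longlonglongrightarrow> exp (- \<delta>)"
  proof -
    have "\<forall>\<^sub>F n in sequentially. (p n ^ m n - e n)\<^sup>2 \<le> K * (real (m n) / real n)"
      using B_bd ev_n
    proof eventually_elim
      case (elim n)
      have "(p n ^ m n - e n)\<^sup>2 \<le> expectation (\<lambda>\<omega>. (p n ^ m n - G n \<omega> ^ m n)\<^sup>2)"
        unfolding e_def by (rule sq_mean)
      also have "\<dots> \<le> expectation (\<lambda>\<omega>. (real (m n))\<^sup>2 * (1 - q n - G n \<omega>)\<^sup>2)"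
      proof (rule integral_mono[OF intGd])
        show "integrable M (\<lambda>\<omega>. (real (m n))\<^sup>2 * (1 - q n - G n \<omega>)\<^sup>2)"
          using intGd[of "1 - q n" n 1] by simp
        fix \<omega>
        have "norm (p n ^ m n - G n \<omega> ^ m n) \<le> real (m n) * norm (p n - G n \<omega>)"
          by (rule norm_power_diff) (use p01[of n] G01[of n \<omega>] in auto)
        then have "\<bar>p n ^ m n - G n \<omega> ^ m n\<bar>\<^sup>2 \<le> (real (m n) * \<bar>p n - G n \<omega>\<bar>)\<^sup>2"
          by (intro power_mono) auto
        then show "(p n ^ m n - G n \<omega> ^ m n)\<^sup>2 \<le> (real (m n))\<^sup>2 * (1 - q n - G n \<omega>)\<^sup>2"
          by (simp add: power_mult_distrib p_def)
      qed
      also have "\<dots> = (real (m n))\<^sup>2 * (v n / real n)" using EG2 elim by simp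
      also have "\<dots> \<le> (real (m n))\<^sup>2 * (q n / real n)"
        by (intro mult_left_mono divide_right_mono v_le) auto
      also have "\<dots> = B n * (real (m n) / real n)" by (simp add: B_def power2_eq_square)
      also have "\<dots> \<le> K * (real (m n) / real n)" using elim by (intro mult_right_mono) auto
      finally show ?case .
    qed
    then have "\<forall>\<^sub>F n in sequentially. norm ((p n ^ m n - e n)\<^sup>2) \<le> K * (real (m n) / real n)" by simp
    then have "(\<lambda>n. (p n ^ m n - e n)\<^sup>2) \<longlonglongrightarrow> 0"
      by (rule Lim_null_comparison) (rule tendsto_mult_right_zero[OF mn])
    then have "(\<lambda>n. p n ^ m n - e n) \<longlonglongrightarrow> 0" by (rule sq0)
    from tendsto_add[OF this e_lim] show ?thesis by simp
  qed
  have q_lim: "q \<longlonglongrightarrow> 0"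
  proof -
    have "(\<lambda>n. K / real (m n)) \<longlonglongrightarrow> 0"
      by (intro tendsto_divide_0[OF tendsto_const] filterlim_at_top_imp_at_infinity m_inf')
    moreover have "\<forall>\<^sub>F n in sequentially. norm (q n) \<le> K / real (m n)"
      using B_bd ev_m by eventually_elim (use q01 in \<open>simp add: B_def field_simps\<close>)
    ultimately show ?thesis by (rule Lim_null_comparison[rotated])
  qed
  have p_lim: "p \<longlonglongrightarrow> 1" unfolding p_def[abs_def] using tendsto_diff[OF tendsto_const q_lim, of 1] by simp
  have ev_p: "\<forall>\<^sub>F n in sequentially. p n > 0" by (rule order_tendstoD(1)[OF p_lim]) simp
  \<comment> \<open>\<open>q \<le> - ln (1 - q) \<le> q / (1 - q)\<close>, multiplied by \<open>m\<close>\<close>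
  have B_lim: "B \<longlonglongrightarrow> \<delta>"
  proof -
    have "(\<lambda>n. - ln (p n ^ m n)) \<longlonglongrightarrow> - ln (exp (- \<delta>))"
      by (intro tendsto_minus tendsto_ln pm) simp
    then have l: "(\<lambda>n. - ln (p n ^ m n)) \<longlonglongrightarrow> \<delta>" by simp
    have l2: "(\<lambda>n. p n * - ln (p n ^ m n)) \<longlonglongrightarrow> \<delta>" using tendsto_mult[OF p_lim l] by simp
    have 1: "\<forall>\<^sub>F n in sequentially. B n \<le> - ln (p n ^ m n)"
      using ev_p
    proof eventually_elim
      case (elim n)
      have "ln (p n) \<le> - q n" using ln_le_minus_one[OF elim] by (simp add: p_def)
      then have "real (m n) * ln (p n) \<le> real (m n) * - q n" by (rule mult_left_mono) simp
      then show ?case using elim by (simp add: B_def ln_realpow)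
    qed
    have 2: "\<forall>\<^sub>F n in sequentially. p n * - ln (p n ^ m n) \<le> B n"
      using ev_p
    proof eventually_elim
      case (elim n)
      have "ln (inverse (p n)) \<le> inverse (p n) - 1" by (rule ln_le_minus_one) (use elim in simp)
      then have "p n * (- ln (p n)) \<le> p n * (inverse (p n) - 1)"
        using elim by (intro mult_left_mono) (auto simp: ln_inverse)
      also have "\<dots> = q n" using elim by (simp add: p_def right_diff_distrib)
      finally have "real (m n) * (p n * (- ln (p n))) \<le> real (m n) * q n" by (rule mult_left_mono) simp
      then show ?case using elim by (simp add: B_def ln_realpow mult_ac)
    qed
    show ?thesis by (rule tendsto_sandwich[OF 2 1 l2 l])
  qed
  have v_lim: "(\<lambda>n. real (m n) * v n) \<longlonglongrightarrow> \<delta>"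
  proof (rule order_tendstoI)
    fix a assume "a > \<delta>"
    then have "\<forall>\<^sub>F n in sequentially. B n < a" by (rule order_tendstoD(2)[OF B_lim])
    then show "\<forall>\<^sub>F n in sequentially. real (m n) * v n < a"
    proof eventually_elim
      case (elim n)
      have "real (m n) * v n \<le> B n" unfolding B_def by (intro mult_left_mono v_le) simp
      then show ?case using elim by simp
    qed
  next
    fix a assume a: "a < \<delta>"
    have "(\<lambda>n. B n * q n) \<longlonglongrightarrow> 0" using tendsto_mult[OF B_lim q_lim] by simp
    then have "\<forall>\<^sub>F n in sequentially. B n * q n < (\<delta> - a) / 2" by (rule order_tendstoD(2)) (use a in simp)
    moreover have "\<forall>\<^sub>F n in sequentially. \<delta> - (\<delta> - a) / 2 \<le> real (m n) * r n"
      by (rule lower) (use a in simp)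
    ultimately show "\<forall>\<^sub>F n in sequentially. a < real (m n) * v n"
    proof eventually_elim
      case (elim n)
      have "real (m n) * v n = real (m n) * r n - B n * q n"
        by (simp add: v_def B_def power2_eq_square algebra_simps)
      then show ?case using elim by argo
    qed
  qed
  have nm: "filterlim (\<lambda>n. real n / real (m n)) at_top sequentially"
  proof -
    have "\<forall>\<^sub>F n in sequentially. 0 < real (m n) / real n" using ev_m ev_n by eventually_elim simp
    from filterlim_inverse_at_top[OF mn this] show ?thesis by (simp add: inverse_eq_divide)
  qed
  have nv: "filterlim (\<lambda>n. real n * v n) at_top sequentially"
  proof -
    have "filterlim (\<lambda>n. (real (m n) * v n) * (real n / real (m n))) at_top sequentially"
      by (rule filterlim_tendsto_pos_mult_at_top[OF v_lim \<delta> nm])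
    moreover have "\<forall>\<^sub>F n in sequentially. (real (m n) * v n) * (real n / real (m n)) = real n * v n"
      using ev_m by eventually_elim simp
    ultimately show ?thesis by (simp add: filterlim_cong)
  qed

  define s where "s n = real (m n) * p n ^ (m n - 1) * sqrt (v n / real n)" for n
  define \<epsilon> where "\<epsilon> n = real (m n) * sqrt (v n / real n) / p n ^ (m n - 1)" for n
  define d where "d n = (c n - p n ^ m n) / s n" for n
  have pm1: "(\<lambda>n. p n ^ (m n - 1)) \<longlonglongrightarrow> exp (- \<delta>)"
  proof -
    have "(\<lambda>n. p n ^ m n / p n) \<longlonglongrightarrow> exp (- \<delta>) / 1" by (intro tendsto_divide pm p_lim) simp
    moreover have "\<forall>\<^sub>F n in sequentially. p n ^ m n / p n = p n ^ (m n - 1)"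
      using ev_p ev_m by eventually_elim (simp add: power_diff)
    ultimately show ?thesis by (simp add: tendsto_cong)
  qed
  have root: "real (m n) * sqrt (v n / real n) = sqrt (real (m n) * v n) * sqrt (real (m n) / real n)" for n
    by (simp add: real_sqrt_divide real_sqrt_mult)
  have ev_v: "\<forall>\<^sub>F n in sequentially. real (m n) * v n > 0" by (rule order_tendstoD(1)[OF v_lim \<delta>])
  have ev_s: "\<forall>\<^sub>F n in sequentially. s n > 0"
    using ev_v ev_m ev_n ev_p by eventually_elim (auto simp: s_def zero_less_mult_iff)
  have \<epsilon>_lim: "\<epsilon> \<longlonglongrightarrow> 0"
  proof -
    have "(\<lambda>n. sqrt (real (m n) * v n) * sqrt (real (m n) / real n) / p n ^ (m n - 1)) \<longlonglongrightarrow> sqrt \<delta> * sqrt 0 / exp (- \<delta>)"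
      by (intro tendsto_intros v_lim mn pm1) simp
    then show ?thesis unfolding \<epsilon>_def[abs_def] root by simp
  qed
  have Ts: "(\<lambda>n. expectation (\<lambda>\<omega>. ((c n - G n \<omega> ^ m n) / s n)\<^sup>2)) \<longlonglongrightarrow> 1"
  proof -
    have "(\<lambda>n. (real n / real (m n) * expectation (\<lambda>\<omega>. (c n - G n \<omega> ^ m n)\<^sup>2)) / ((real (m n) * v n) * (p n ^ (m n - 1))\<^sup>2))
        \<longlonglongrightarrow> (\<delta> * exp (- 2 * \<delta>)) / (\<delta> * (exp (- \<delta>))\<^sup>2)"
      by (intro tendsto_intros mse v_lim pm1) (use \<delta> in simp)
    also have "(\<delta> * exp (- 2 * \<delta>)) / (\<delta> * (exp (- \<delta>))\<^sup>2) = 1"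
      using \<delta> by (simp add: exp_of_nat_mult[of 2 "- \<delta>", symmetric])
    finally have lim: "(\<lambda>n. (real n / real (m n) * expectation (\<lambda>\<omega>. (c n - G n \<omega> ^ m n)\<^sup>2)) / ((real (m n) * v n) * (p n ^ (m n - 1))\<^sup>2)) \<longlonglongrightarrow> 1" .
    have "\<forall>\<^sub>F n in sequentially. (real n / real (m n) * expectation (\<lambda>\<omega>. (c n - G n \<omega> ^ m n)\<^sup>2)) / ((real (m n) * v n) * (p n ^ (m n - 1))\<^sup>2)
       = expectation (\<lambda>\<omega>. ((c n - G n \<omega> ^ m n) / s n)\<^sup>2)"
      using ev_v ev_m ev_n
    proof eventually_elim
      case (elim n)
      have v0: "v n > 0" using elim by (simp add: zero_less_mult_iff)
      have "(s n)\<^sup>2 = (real (m n))\<^sup>2 * (p n ^ (m n - 1))\<^sup>2 * (v n / real n)"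
        using v0 by (simp add: s_def power_mult_distrib)
      moreover define Q where "Q = expectation (\<lambda>\<omega>. (c n - G n \<omega> ^ m n)\<^sup>2)"
      moreover have "expectation (\<lambda>\<omega>. ((c n - G n \<omega> ^ m n) / s n)\<^sup>2) = Q / (s n)\<^sup>2"
        by (simp add: power_divide Q_def)
      moreover have "real n / real (m n) * Q / (real (m n) * v n * (p n ^ (m n - 1))\<^sup>2)
          = Q / ((real (m n))\<^sup>2 * (p n ^ (m n - 1))\<^sup>2 * (v n / real n))" for Q
        using elim v0 by (simp add: field_simps power2_eq_square)
      ultimately show ?case by simp
    qed
    with lim show ?thesis by (rule Lim_transform_eventually)
  qed
  have ev_nv: "\<forall>\<^sub>F n in sequentially. real n * v n \<ge> 1"
    using nv by (auto simp: filterlim_at_top)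
  have per_n: "(d n)\<^sup>2 \<le> (1 + \<epsilon> n) * expectation (\<lambda>\<omega>. ((c n - G n \<omega> ^ m n) / s n)\<^sup>2) + 4 * (\<epsilon> n)\<^sup>2 + 4 * \<epsilon> n - 1"
    "cmod (char (distr M borel (\<lambda>\<omega>. (c n - G n \<omega> ^ m n - b n) / s n)) t
        - char (distr M borel (\<lambda>\<omega>. (\<Sum>i<n. Z n i \<omega>) / sqrt (real n * v n))) t)
        \<le> \<bar>t\<bar> * (\<epsilon> n + \<bar>d n\<bar> + \<bar>b n\<bar> / s n)"
    if n: "n > 0" "m n > 0" "p n > 0" "real n * v n \<ge> 1" for n t
  proof -
    have Ge: "G n = (\<lambda>\<omega>. p n - (\<Sum>i<n. Z n i \<omega>) / real n)" using G_eq[OF n(1)] by (auto simp: p_def)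
    have g: "0 \<le> p n - (\<Sum>i<n. Z n i \<omega>) / real n \<and> p n - (\<Sum>i<n. Z n i \<omega>) / real n \<le> 1" for \<omega>
      using G01[of n \<omega>] unfolding Ge by simp
    note D = power_of_mean_delta[OF Z_indep Z_bd Z_mean Z_var n(1,2,3) p01(2) n(4) g]
    show "(d n)\<^sup>2 \<le> (1 + \<epsilon> n) * expectation (\<lambda>\<omega>. ((c n - G n \<omega> ^ m n) / s n)\<^sup>2) + 4 * (\<epsilon> n)\<^sup>2 + 4 * \<epsilon> n - 1"
      using D(1)[of "c n"] unfolding d_def s_def \<epsilon>_def Ge .
    show "cmod (char (distr M borel (\<lambda>\<omega>. (c n - G n \<omega> ^ m n - b n) / s n)) t
        - char (distr M borel (\<lambda>\<omega>. (\<Sum>i<n. Z n i \<omega>) / sqrt (real n * v n))) t)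
        \<le> \<bar>t\<bar> * (\<epsilon> n + \<bar>d n\<bar> + \<bar>b n\<bar> / s n)"
      using D(2)[of "c n" "b n" t] unfolding d_def s_def \<epsilon>_def Ge .
  qed
  have ev_all: "\<forall>\<^sub>F n in sequentially. n > 0 \<and> m n > 0 \<and> p n > 0 \<and> real n * v n \<ge> 1"
    using ev_n ev_m ev_p ev_nv by eventually_elim simp
  have d_lim: "d \<longlonglongrightarrow> 0"
  proof (rule sq0)
    have "(\<lambda>n. (1 + \<epsilon> n) * expectation (\<lambda>\<omega>. ((c n - G n \<omega> ^ m n) / s n)\<^sup>2) + 4 * (\<epsilon> n)\<^sup>2 + 4 * \<epsilon> n - 1)
       \<longlonglongrightarrow> (1 + 0) * 1 + 4 * 0\<^sup>2 + 4 * 0 - 1"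
      by (intro tendsto_intros Ts \<epsilon>_lim)
    then have "(\<lambda>n. (1 + \<epsilon> n) * expectation (\<lambda>\<omega>. ((c n - G n \<omega> ^ m n) / s n)\<^sup>2) + 4 * (\<epsilon> n)\<^sup>2 + 4 * \<epsilon> n - 1)
       \<longlonglongrightarrow> 0" by simp
    then show "(\<lambda>n. (d n)\<^sup>2) \<longlonglongrightarrow> 0"
    proof (rule Lim_null_comparison[rotated])
      show "\<forall>\<^sub>F n in sequentially. norm ((d n)\<^sup>2) \<le> (1 + \<epsilon> n) * expectation (\<lambda>\<omega>. ((c n - G n \<omega> ^ m n) / s n)\<^sup>2) + 4 * (\<epsilon> n)\<^sup>2 + 4 * \<epsilon> n - 1"
        using ev_all by eventually_elim (use per_n(1) in auto)
    qed
  qed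
  have bs_lim: "(\<lambda>n. \<bar>b n\<bar> / s n) \<longlonglongrightarrow> 0"
  proof -
    have "(\<lambda>n. \<bar>b n / sqrt (real (m n) / real n)\<bar> / (sqrt (real (m n) * v n) * p n ^ (m n - 1))) \<longlonglongrightarrow> \<bar>0\<bar> / (sqrt \<delta> * exp (- \<delta>))"
      by (intro tendsto_intros b v_lim pm1) (use \<delta> in simp)
    moreover have eq: "\<bar>b n / sqrt (real (m n) / real n)\<bar> / (sqrt (real (m n) * v n) * p n ^ (m n - 1)) = \<bar>b n\<bar> / s n" for n
    proof -
      have "s n = sqrt (real (m n) / real n) * (sqrt (real (m n) * v n) * p n ^ (m n - 1))"
        using root[of n] by (simp add: s_def mult_ac)
      then show ?thesis by (simp add: abs_divide)
    qed
    ultimately show ?thesis unfolding eq by simp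
  qed
  \<comment> \<open>The scale must be positive for every index, also before \<open>s n > 0\<close> holds\<close>
  define s' where "s' n = (if s n > 0 then s n else 1)" for n
  have "weak_conv_m (\<lambda>n. distr M borel (\<lambda>\<omega>. (c n - G n \<omega> ^ m n - b n) / s' n)) std_normal_distribution"
  proof (rule levy_continuity)
    show "real_distribution (distr M borel (\<lambda>\<omega>. (c n - G n \<omega> ^ m n - b n) / s' n))" for n
      by (rule real_distribution_distr) measurable
    show "real_distribution std_normal_distribution" by (rule real_dist_normal_dist)
    fix t
    let ?V = "\<lambda>n. char (distr M borel (\<lambda>\<omega>. (\<Sum>i<n. Z n i \<omega>) / sqrt (real n * v n))) t"
    have "?V \<longlonglongrightarrow> char std_normal_distribution t"
      by (rule char_normalized_sum_tendsto[OF Z_indep Z_bd Z_mean Z_var nv])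
    moreover have "(\<lambda>n. char (distr M borel (\<lambda>\<omega>. (c n - G n \<omega> ^ m n - b n) / s' n)) t - ?V n) \<longlonglongrightarrow> 0"
    proof (rule Lim_null_comparison)
      show "\<forall>\<^sub>F n in sequentially. cmod (char (distr M borel (\<lambda>\<omega>. (c n - G n \<omega> ^ m n - b n) / s' n)) t - ?V n)
          \<le> \<bar>t\<bar> * (\<epsilon> n + \<bar>d n\<bar> + \<bar>b n\<bar> / s n)"
        using ev_all ev_s
      proof eventually_elim
        case (elim n)
        then have "s' n = s n" by (simp add: s'_def)
        then show ?case using per_n(2)[of n t] elim by simp
      qed
      have "(\<lambda>n. \<bar>t\<bar> * (\<epsilon> n + \<bar>d n\<bar> + \<bar>b n\<bar> / s n)) \<longlonglongrightarrow> \<bar>t\<bar> * (0 + \<bar>0\<bar> + 0)"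
        by (intro tendsto_intros \<epsilon>_lim d_lim bs_lim)
      then show "(\<lambda>n. \<bar>t\<bar> * (\<epsilon> n + \<bar>d n\<bar> + \<bar>b n\<bar> / s n)) \<longlonglongrightarrow> 0" by simp
    qed
    ultimately show "(\<lambda>n. char (distr M borel (\<lambda>\<omega>. (c n - G n \<omega> ^ m n - b n) / s' n)) t) \<longlonglongrightarrow> char std_normal_distribution t"
      by (rule Lim_transform)
  qed
  moreover have "\<forall>n. s' n > 0" by (simp add: s'_def)
  ultimately show ?thesis by blast
qed

section \<open>Moments of the smoothing kernel\<close>

lemma kernel_range:
  assumes "smoothing_kernel W w"
  shows "0 \<le> W z" "W z \<le> 1"
proof -
  have W: "mono W" "(W \<longlongrightarrow> 0) at_bot" "(W \<longlongrightarrow> 1) at_top"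
    using assms by (auto simp: smoothing_kernel_def)
  have "\<forall>\<^sub>F y in at_bot. W y \<le> W z"
    using eventually_le_at_bot[of z] by eventually_elim (rule monoD[OF W(1)])
  then show "0 \<le> W z" by (rule tendsto_upperbound[OF W(2)]) simp
  have "\<forall>\<^sub>F y in at_top. W z \<le> W y"
    using eventually_ge_at_top[of z] by eventually_elim (rule monoD[OF W(1)])
  then show "W z \<le> 1" by (rule tendsto_lowerbound[OF W(3)]) simp
qed

text \<open>\<open>W z + W (- z)\<close> has derivative \<open>w z - w (- z) = 0\<close>, and its limit at infinity is \<open>1\<close>.\<close>

lemma kernel_reflect:
  assumes "smoothing_kernel W w"
  shows "W (- z) = 1 - W z"
proof -
  have W: "(W \<longlongrightarrow> 0) at_bot" "(W \<longlongrightarrow> 1) at_top"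
    and der: "\<And>z. (W has_real_derivative w z) (at z)" and sym: "\<And>z. w (- z) = w z"
    using assms by (auto simp: smoothing_kernel_def)
  have "((\<lambda>z. W z + W (- z)) has_real_derivative 0) (at z)" for z
  proof -
    have "((\<lambda>z. W (- z)) has_real_derivative w (- z) * (- 1)) (at z)"
      by (rule DERIV_chain2[OF der]) (auto intro!: derivative_eq_intros)
    from DERIV_add[OF der this] show ?thesis by (simp add: sym)
  qed
  then have const: "W y + W (- y) = W z + W (- z)" for y
    using DERIV_isconst_all[of "\<lambda>z. W z + W (- z)"] by blast
  have "((\<lambda>y. W (- y)) \<longlongrightarrow> 0) at_top"
    by (rule filterlim_compose[OF W(1) filterlim_uminus_at_bot_at_top])
  from tendsto_add[OF W(2) this] have *: "((\<lambda>y. W y + W (- y)) \<longlongrightarrow> 1) at_top" by simp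
  have "((\<lambda>y. W z + W (- z)) \<longlongrightarrow> 1) (at_top :: real filter)"
  proof -
    have "(\<lambda>y. W y + W (- y)) = (\<lambda>_. W z + W (- z))" using const by (intro ext)
    then show ?thesis using * by (simp only:)
  qed
  then show ?thesis by (simp add: tendsto_const_iff)
qed

lemma kernel_density_nonneg:
  assumes "smoothing_kernel W w"
  shows "0 \<le> w z"
  using assms mono_on_imp_deriv_nonneg[of UNIV W "w z" z] by (simp add: smoothing_kernel_def)

text \<open>Positivity off the origin is what the moment integrals need, because their integrands vanish at
\<open>0\<close>. If the continuous density \<open>w\<close> vanished off the origin, \<open>W\<close> would be constant.\<close>

lemma kernel_density_pos:
  assumes "smoothing_kernel W w"
  obtains z where "z > 0" "w z > 0"
proof -
  have der: "\<And>z. (W has_real_derivative w z) (at z)" and sym: "\<And>z. w (- z) = w z"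
    and cont: "continuous_on UNIV w" and W: "(W \<longlongrightarrow> 0) at_bot" "(W \<longlongrightarrow> 1) at_top"
    using assms by (auto simp: smoothing_kernel_def)
  have "\<exists>z>0. w z > 0"
  proof (rule ccontr)
    assume "\<not> ?thesis"
    then have pos: "w z = 0" if "z > 0" for z
      using kernel_density_nonneg[OF assms, of z] that by (meson antisym not_less)
    then have nz: "w z = 0" if "z \<noteq> 0" for z using that sym[of z] pos[of z] pos[of "- z"] by linarith
    have "isCont w 0" using cont by (simp add: continuous_on_eq_continuous_at)
    then have "(w \<longlongrightarrow> w 0) (at 0)" by (simp add: isCont_def)
    moreover have "(w \<longlongrightarrow> 0) (at 0)"
      by (rule Lim_transform_eventually[OF tendsto_const]) (auto simp: eventually_at_filter nz)
    ultimately have "w 0 = 0" by (rule tendsto_unique[rotated]) simp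
    then have "\<forall>z. (W has_real_derivative 0) (at z)" using nz der by (metis (full_types))
    then have c: "W y = W 0" for y by (rule DERIV_isconst_all)
    have "W = (\<lambda>_. W 0)" using c by auto
    then have "((\<lambda>_. W 0) \<longlongrightarrow> 0) (at_bot :: real filter)" "((\<lambda>_. W 0) \<longlongrightarrow> 1) (at_top :: real filter)"
      using W by metis+
    then show False by (simp add: tendsto_const_iff)
  qed
  then show ?thesis using that by blast
qed

lemma lborel_integral_pos_of_continuous:
  fixes g :: "real \<Rightarrow> real"
  assumes cont: "continuous_on UNIV g" and int: "integrable lborel g"
    and nonneg: "\<And>z. 0 \<le> g z" and pos: "0 < g z0"
  shows "0 < (LBINT z. g z)"
proof (rule ccontr)
  assume "\<not> ?thesis"
  moreover have "0 \<le> (LBINT z. g z)" by (rule Bochner_Integration.integral_nonneg) (rule nonneg)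
  ultimately have "(LBINT z. g z) = 0" by simp
  then have "AE z in lborel. g z = 0"
    using integral_nonneg_eq_0_iff_AE[OF int] nonneg by simp
  moreover have opn: "open {z. g z \<noteq> 0}"
    by (intro open_Collect_neq cont continuous_on_const)
  ultimately have "{z. g z \<noteq> 0} \<in> null_sets lborel"
    by (subst AE_iff_null_sets) auto
  then have "negligible {z. g z \<noteq> 0}"
    by (simp add: negligible_iff_null_sets null_sets_completionI)
  then show False using open_not_negligible[OF opn] pos by fastforce
qed

lemma kernel_second_moment_pos:
  assumes "smoothing_kernel W w" "integrable lborel (\<lambda>z. z\<^sup>2 * w z)"
  shows "0 < (LBINT z. z\<^sup>2 * w z)"
proof -
  obtain z where z: "z > 0" "w z > 0" by (rule kernel_density_pos[OF assms(1)])
  have cont: "continuous_on UNIV (\<lambda>z. z\<^sup>2 * w z)"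
    using assms(1) by (intro continuous_intros) (simp add: smoothing_kernel_def)
  have nonneg: "0 \<le> y\<^sup>2 * w y" for y using kernel_density_nonneg[OF assms(1)] by simp
  have pos: "0 < z\<^sup>2 * w z" using z by simp
  show ?thesis by (rule lborel_integral_pos_of_continuous[OF cont assms(2) nonneg pos])
qed

text \<open>Reflecting \<open>z\<close> and averaging turns the integrand into \<open>z (W z - W (- z)) w z / 2\<close>, which is nonnegative
because \<open>W\<close> is monotone, and positive wherever \<open>z > 0\<close> and \<open>w z > 0\<close>.\<close>

lemma kernel_mixed_moment_pos:
  assumes K: "smoothing_kernel W w" and int: "integrable lborel (\<lambda>z. z * W z * w z)"
  shows "0 < (LBINT z. z * W z * w z)"
proof -
  have der: "\<And>z. (W has_real_derivative w z) (at z)" and sym: "\<And>z. w (- z) = w z"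
    and cont: "continuous_on UNIV w" and mono: "mono W"
    using K by (auto simp: smoothing_kernel_def)
  have contW: "continuous_on UNIV W"
    using der by (meson DERIV_isCont continuous_at_imp_continuous_on)
  have int': "integrable lborel (\<lambda>z. - (z * W (- z) * w z))"
    using lborel_integrable_real_affine[OF int, of "- 1" 0] by (simp add: sym)
  have eq': "(LBINT z. - (z * W (- z) * w z)) = (LBINT z. z * W z * w z)"
    using lborel_integral_real_affine[of "- 1" "\<lambda>z. z * W z * w z" 0] by (simp add: sym)
  have eq: "(\<lambda>z. z * W z * w z + - (z * W (- z) * w z)) = (\<lambda>z. z * (W z - W (- z)) * w z)"
    by (auto simp: algebra_simps)
  obtain z where z: "z > 0" "w z > 0" by (rule kernel_density_pos[OF K])
  have c: "continuous_on UNIV (\<lambda>z. z * (W z - W (- z)) * w z)"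
    by (intro continuous_intros cont contW continuous_on_compose2[OF contW]) auto
  have i: "integrable lborel (\<lambda>z. z * (W z - W (- z)) * w z)"
    using Bochner_Integration.integrable_add[OF int int'] unfolding eq .
  have nonneg: "0 \<le> y * (W y - W (- y)) * w y" for y
  proof (rule mult_nonneg_nonneg[OF _ kernel_density_nonneg[OF K]])
    show "0 \<le> y * (W y - W (- y))"
    proof (cases "y \<ge> 0")
      case True then show ?thesis using monoD[OF mono, of "- y" y] by simp
    next
      case False then show ?thesis using monoD[OF mono, of y "- y"] by (intro mult_nonpos_nonpos) auto
    qed
  qed
  obtain d where d: "d > 0" "\<And>h. 0 < h \<Longrightarrow> h < d \<Longrightarrow> W (z - h) < W z"
    using DERIV_pos_inc_left[OF der z(2)] by blast
  define h where "h = min (d / 2) z"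
  have h: "0 < h" "h < d" "h \<le> z" using d z by (auto simp: h_def min_def)
  have "W (- z) \<le> W (z - h)" by (rule monoD[OF mono]) (use h z in linarith)
  also have "\<dots> < W z" by (rule d(2)[OF h(1,2)])
  finally have pos: "0 < z * (W z - W (- z)) * w z" using z by simp
  have "0 < (LBINT z. z * (W z - W (- z)) * w z)"
    by (rule lborel_integral_pos_of_continuous[OF c i nonneg pos])
  also have "\<dots> = (LBINT z. z * W z * w z) + (LBINT z. - (z * W (- z) * w z))"
    by (subst Bochner_Integration.integral_add[OF int int', symmetric]) (simp only: eq)
  finally show ?thesis using eq' by simp
qed

section \<open>The leading tail and its length scale\<close>

text \<open>The length scale on which the tail of the class varies near \<open>x\<close>: up to a constant, \<open>x\<close> itself, the
reciprocal hazard rate, or the distance to the endpoint. The constants are normalized such that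
\<open>lead_dens = xi\<^sup>2 * lead_tail * tail_scale\<^sup>3\<close>, which makes the optimal bandwidth a multiple of this scale by
a factor that is the same for all three classes.\<close>

fun tail_scale :: "tail_class \<Rightarrow> real \<Rightarrow> real" where
  "tail_scale (Hall \<alpha> \<beta> A B) x = x / (\<alpha> * (\<alpha> + 1)\<^sup>2) powr (1/3)"
| "tail_scale (Weibull \<kappa> C) x = x powr (1 - \<kappa>) / (\<kappa> * C)"
| "tail_scale (Bounded xs \<mu> \<sigma> D E) x = (xs - x) / (- \<mu> * (\<mu> + 1)\<^sup>2) powr (1/3)"

lemma powr_third_cube: "(a::real) \<ge> 0 \<Longrightarrow> (a powr (1/3)) ^ 3 = a"
  by (cases "a = 0") (simp_all add: powr_powr flip: powr_numeral)

lemma eventually_in_domain: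
  "\<forall>\<^sub>F x in endpoint_filter (Hall \<alpha> \<beta> A B). x > 0"
  "\<forall>\<^sub>F x in endpoint_filter (Weibull \<kappa> C). x > 0"
  "\<forall>\<^sub>F x in endpoint_filter (Bounded xs \<mu> \<sigma> D E). xs - x > 0"
  by (auto simp: eventually_gt_at_top eventually_at_left_field intro: exI[of _ "xs - 1"])

text \<open>These identities are all that the three classes must provide for the computation with the
bandwidth: the minimizer and the minimum of the criterion follow from them uniformly.\<close>

lemma tail_scale_identities:
  assumes "in_class F p"
  obtains c where "c > 0"
    "\<forall>\<^sub>F x in endpoint_filter p. lead_tail p x > 0 \<and> tail_scale p x > 0 \<and> xi p x * (tail_scale p x)\<^sup>2 = c \<and>
       lead_dens p x = (xi p x)\<^sup>2 * lead_tail p x * tail_scale p x ^ 3"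
proof (cases p)
  case (Hall \<alpha> \<beta> A B)
  have par: "\<alpha> > 0" "A > 0" using assms Hall by auto
  define k where "k = (\<alpha> * (\<alpha> + 1)\<^sup>2) powr (1/3)"
  have k0: "k > 0" using par by (simp add: k_def)
  have k3: "k ^ 3 = \<alpha> * (\<alpha> + 1)\<^sup>2" unfolding k_def by (rule powr_third_cube) (use par in simp)
  show ?thesis
  proof (rule that[of "\<alpha> * (\<alpha> + 1) / k\<^sup>2"])
    show "\<alpha> * (\<alpha> + 1) / k\<^sup>2 > 0" using par k0 by simp
    show "\<forall>\<^sub>F x in endpoint_filter p. lead_tail p x > 0 \<and> tail_scale p x > 0 \<and> xi p x * (tail_scale p x)\<^sup>2 = \<alpha> * (\<alpha> + 1) / k\<^sup>2 \<and>
       lead_dens p x = (xi p x)\<^sup>2 * lead_tail p x * tail_scale p x ^ 3"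
      using eventually_in_domain(1)[of \<alpha> \<beta> A B] unfolding Hall
    proof eventually_elim
      case (elim x)
      have x2: "x powr (-2) = inverse (x\<^sup>2)" using elim by (simp add: powr_minus)
      have x1: "x powr (- \<alpha> - 1) = x powr (- \<alpha>) / x" using elim by (simp add: powr_diff)
      have ts: "tail_scale (Hall \<alpha> \<beta> A B) x = x / k" by (simp add: k_def)
      have cube: "(x / k) ^ 3 = x ^ 3 / (\<alpha> * (\<alpha> + 1)\<^sup>2)" by (simp add: power_divide k3)
      have "lead_dens (Hall \<alpha> \<beta> A B) x = (xi (Hall \<alpha> \<beta> A B) x)\<^sup>2 * lead_tail (Hall \<alpha> \<beta> A B) x * (x / k) ^ 3"
        using elim par unfolding xi.simps lead_dens.simps lead_tail.simps x1 x2 cube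
        by (simp add: power2_eq_square power3_eq_cube divide_simps)
      moreover have "xi (Hall \<alpha> \<beta> A B) x * (x / k)\<^sup>2 = \<alpha> * (\<alpha> + 1) / k\<^sup>2"
        using elim k0 unfolding xi.simps x2 by (simp add: field_simps)
      moreover have "x / k > 0" "lead_tail (Hall \<alpha> \<beta> A B) x > 0" using elim k0 par by simp_all
      ultimately show ?case unfolding ts by simp
    qed
  qed
next
  case (Weibull \<kappa> C)
  have par: "\<kappa> > 0" "C > 0" using assms Weibull by auto
  show ?thesis
  proof (rule that[of 1])
    show "\<forall>\<^sub>F x in endpoint_filter p. lead_tail p x > 0 \<and> tail_scale p x > 0 \<and> xi p x * (tail_scale p x)\<^sup>2 = 1 \<and>
       lead_dens p x = (xi p x)\<^sup>2 * lead_tail p x * tail_scale p x ^ 3"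
      using eventually_in_domain(2)[of \<kappa> C] unfolding Weibull
    proof eventually_elim
      case (elim x)
      define y where "y = x powr (\<kappa> - 1)"
      have y0: "y > 0" using elim by (simp add: y_def)
      have y2: "x powr (2 * \<kappa> - 2) = y\<^sup>2"
        using powr_add[of x "\<kappa> - 1" "\<kappa> - 1"] by (simp add: y_def power2_eq_square algebra_simps)
      have y': "x powr (1 - \<kappa>) = inverse y"
        using powr_minus[of x "\<kappa> - 1"] by (simp add: y_def)
      show ?case using y0 par unfolding lead_tail.simps tail_scale.simps xi.simps lead_dens.simps y2 y' y_def[symmetric]
        by (simp add: power2_eq_square power3_eq_cube field_simps)
    qed
  qed simp
next
  case (Bounded xs \<mu> \<sigma> D E)
  have par: "\<mu> < -2" "D > 0" using assms Bounded by auto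
  define k where "k = (- \<mu> * (\<mu> + 1)\<^sup>2) powr (1/3)"
  have mm: "- \<mu> * (\<mu> + 1)\<^sup>2 > 0" using par by (intro mult_pos_pos) auto
  have k0: "k > 0" using par unfolding k_def by simp
  have k3: "k ^ 3 = - \<mu> * (\<mu> + 1)\<^sup>2" unfolding k_def by (rule powr_third_cube) (use mm in simp)
  have xi0: "\<mu> * (\<mu> + 1) > 0" using par by (intro mult_neg_neg) auto
  show ?thesis
  proof (rule that[of "\<mu> * (\<mu> + 1) / k\<^sup>2"])
    show "\<mu> * (\<mu> + 1) / k\<^sup>2 > 0" using xi0 k0 by simp
    show "\<forall>\<^sub>F x in endpoint_filter p. lead_tail p x > 0 \<and> tail_scale p x > 0 \<and> xi p x * (tail_scale p x)\<^sup>2 = \<mu> * (\<mu> + 1) / k\<^sup>2 \<and>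
       lead_dens p x = (xi p x)\<^sup>2 * lead_tail p x * tail_scale p x ^ 3"
      using eventually_in_domain(3)[of xs \<mu> \<sigma> D E] unfolding Bounded
    proof eventually_elim
      case (elim x)
      define y where "y = xs - x"
      have y0: "y > 0" using elim by (simp add: y_def)
      have x2: "y powr (-2) = inverse (y\<^sup>2)" using y0 by (simp add: powr_minus)
      have x1: "y powr (- \<mu> - 1) = y powr (- \<mu>) / y" using y0 by (simp add: powr_diff)
      have ts: "tail_scale (Bounded xs \<mu> \<sigma> D E) x = y / k" by (simp add: k_def y_def)
      have cube: "(y / k) ^ 3 = y ^ 3 / (- \<mu> * (\<mu> + 1)\<^sup>2)" by (simp add: power_divide k3)
      have "lead_dens (Bounded xs \<mu> \<sigma> D E) x = (xi (Bounded xs \<mu> \<sigma> D E) x)\<^sup>2 * lead_tail (Bounded xs \<mu> \<sigma> D E) x * (y / k) ^ 3"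
        using y0 par unfolding xi.simps lead_dens.simps lead_tail.simps y_def[symmetric] x1 x2 cube
        by (simp add: power2_eq_square power3_eq_cube divide_simps)
      moreover have "xi (Bounded xs \<mu> \<sigma> D E) x * (y / k)\<^sup>2 = \<mu> * (\<mu> + 1) / k\<^sup>2"
        using y0 k0 unfolding xi.simps y_def[symmetric] x2 by (simp add: field_simps)
      moreover have "y / k > 0" "lead_tail (Bounded xs \<mu> \<sigma> D E) x > 0" using y0 k0 par
        unfolding lead_tail.simps y_def[symmetric] by simp_all
      ultimately show ?case unfolding ts by simp
    qed
  qed
qed

text \<open>In each class the remainder and the second-order term are small relative to the leading term:
in the Hall and the bounded class, multiplying the defining limit by \<open>x powr (- \<beta>)\<close>, respectively
\<open>(xs - x) powr (- \<sigma>)\<close>, which both tend to \<open>0\<close>, gives the claim; in the Weibull class the defining limit is already relative to the leading term.\<close>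

lemma lead_tail_asymp:
  assumes "in_class F p"
  shows "((\<lambda>x. (1 - F x) / lead_tail p x) \<longlongrightarrow> 1) (endpoint_filter p)"
proof (cases p)
  case (Hall \<alpha> \<beta> A B)
  have par: "\<alpha> > 0" "\<beta> \<ge> 1/2" "A > 0"
    and lim: "((\<lambda>x. x powr (\<alpha> + \<beta>) * (1 - F x - A * x powr (-\<alpha>) * (1 + B * x powr (-\<beta>)))) \<longlongrightarrow> 0) at_top"
    using assms Hall by auto
  have b: "((\<lambda>x. x powr (-\<beta>)) \<longlongrightarrow> 0) at_top"
    by (rule tendsto_neg_powr) (use par in \<open>auto simp: filterlim_ident\<close>)
  let ?g = "\<lambda>x. x powr (\<alpha> + \<beta>) * (1 - F x - A * x powr (-\<alpha>) * (1 + B * x powr (-\<beta>)))"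
  have "((\<lambda>x. 1 + B * x powr (-\<beta>) + x powr (-\<beta>) * ?g x / A) \<longlongrightarrow> 1 + B * 0 + 0 * 0 / A) at_top"
    by (intro tendsto_intros b lim) (use par in auto)
  then have "((\<lambda>x. 1 + B * x powr (-\<beta>) + x powr (-\<beta>) * ?g x / A) \<longlongrightarrow> 1) at_top" by simp
  moreover have "\<forall>\<^sub>F x in at_top. 1 + B * x powr (-\<beta>) + x powr (-\<beta>) * ?g x / A = (1 - F x) / lead_tail p x"
    using eventually_gt_at_top[of 0]
  proof eventually_elim
    case (elim x)
    have "x powr (-\<beta>) * x powr (\<alpha> + \<beta>) = x powr \<alpha>" by (simp flip: powr_add)
    then have "x powr (-\<beta>) * ?g x = x powr \<alpha> * (1 - F x - A * x powr (-\<alpha>) * (1 + B * x powr (-\<beta>)))"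
      by (simp only: mult.assoc[symmetric])
    also have "\<dots> = x powr \<alpha> * (1 - F x) - A * (1 + B * x powr (-\<beta>))"
      using elim by (simp add: powr_minus field_simps)
    finally have "x powr (-\<beta>) * ?g x / A = x powr \<alpha> * (1 - F x) / A - (1 + B * x powr (-\<beta>))"
      using par by (simp add: diff_divide_distrib)
    moreover have "(1 - F x) / lead_tail p x = x powr \<alpha> * (1 - F x) / A"
      using elim by (simp add: Hall powr_minus field_simps)
    ultimately show ?case by linarith
  qed
  ultimately show ?thesis unfolding Hall endpoint_filter.simps by (rule Lim_transform_eventually)
next
  case (Weibull \<kappa> C)
  have lim: "((\<lambda>x. exp (C * x powr \<kappa>) * (1 - F x - exp (- C * x powr \<kappa>))) \<longlongrightarrow> 0) at_top"
    using assms Weibull by auto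
  have "((\<lambda>x. exp (C * x powr \<kappa>) * (1 - F x - exp (- C * x powr \<kappa>)) + 1) \<longlongrightarrow> 0 + 1) at_top"
    by (intro tendsto_intros lim)
  moreover have "exp (C * x powr \<kappa>) * (1 - F x - exp (- C * x powr \<kappa>)) + 1 = (1 - F x) / exp (- C * x powr \<kappa>)" for x
    by (simp add: exp_minus field_simps)
  ultimately show ?thesis by (simp add: Weibull)
next
  case (Bounded xs \<mu> \<sigma> D E)
  have par: "\<mu> < -2" "\<sigma> \<le> -1/2" "D > 0"
    and lim: "((\<lambda>x. (xs - x) powr (\<mu> + \<sigma>) * (1 - F x - (xs - x) powr (-\<mu>) * (D + E * (xs - x) powr (-\<sigma>)))) \<longlongrightarrow> 0) (at_left xs)"
    using assms Bounded by auto
  have y: "((\<lambda>x. xs - x) \<longlongrightarrow> 0) (at_left xs)"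
    by (rule tendsto_eq_intros refl | simp)+
  have pos: "\<forall>\<^sub>F x in at_left xs. xs - x > 0" using eventually_in_domain(3)[of xs] by simp
  have "((\<lambda>x. (xs - x) powr (-\<sigma>)) \<longlongrightarrow> 0 powr (-\<sigma>)) (at_left xs)"
    by (rule tendsto_powr2[OF y tendsto_const]) (use pos par in \<open>auto elim: eventually_mono\<close>)
  then have b: "((\<lambda>x. (xs - x) powr (-\<sigma>)) \<longlongrightarrow> 0) (at_left xs)" by simp
  let ?g = "\<lambda>x. (xs - x) powr (\<mu> + \<sigma>) * (1 - F x - (xs - x) powr (-\<mu>) * (D + E * (xs - x) powr (-\<sigma>)))"
  have "((\<lambda>x. 1 + E * (xs - x) powr (-\<sigma>) / D + (xs - x) powr (-\<sigma>) * ?g x / D) \<longlongrightarrow> 1 + E * 0 / D + 0 * 0 / D) (at_left xs)"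
    by (intro tendsto_intros b lim) (use par in auto)
  then have "((\<lambda>x. 1 + E * (xs - x) powr (-\<sigma>) / D + (xs - x) powr (-\<sigma>) * ?g x / D) \<longlongrightarrow> 1) (at_left xs)" by simp
  moreover have "\<forall>\<^sub>F x in at_left xs. 1 + E * (xs - x) powr (-\<sigma>) / D + (xs - x) powr (-\<sigma>) * ?g x / D = (1 - F x) / lead_tail p x"
    using pos
  proof eventually_elim
    case (elim x)
    have "(xs - x) powr (-\<sigma>) * (xs - x) powr (\<mu> + \<sigma>) = (xs - x) powr \<mu>" by (simp flip: powr_add)
    then have "(xs - x) powr (-\<sigma>) * ?g x = (xs - x) powr \<mu> * (1 - F x - (xs - x) powr (-\<mu>) * (D + E * (xs - x) powr (-\<sigma>)))"
      by (simp only: mult.assoc[symmetric])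
    also have "\<dots> = (xs - x) powr \<mu> * (1 - F x) - (xs - x) powr \<mu> * (xs - x) powr (- \<mu>) * (D + E * (xs - x) powr (-\<sigma>))"
      by (simp only: right_diff_distrib mult.assoc)
    also have "(xs - x) powr \<mu> * (xs - x) powr (- \<mu>) = 1" using elim by (simp flip: powr_add)
    finally have "(xs - x) powr (-\<sigma>) * ?g x / D = (xs - x) powr \<mu> * (1 - F x) / D - (1 + E * (xs - x) powr (-\<sigma>) / D)"
      using par by (simp add: diff_divide_distrib add_divide_distrib)
    moreover have "(1 - F x) / lead_tail p x = (xs - x) powr \<mu> * (1 - F x) / D"
      using elim by (simp add: Bounded powr_minus field_simps)
    ultimately show ?case by linarith
  qed
  ultimately show ?thesis unfolding Bounded endpoint_filter.simps by (rule Lim_transform_eventually)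
qed

text \<open>Displacements of smaller order than the tail scale leave the leading tail unchanged to first
order. For the power tails the ratio is a power of \<open>1 + u / x\<close>, respectively \<open>1 - u / (xs - x)\<close>. In the
Weibull class the exponent changes by \<open>- C x\<^sup>\<kappa> ((1 + u / x)\<^sup>\<kappa> - 1)\<close>, which is of order
\<open>u / x powr (1 - \<kappa>)\<close>.\<close>

lemma lead_tail_shift:
  fixes x u :: "nat \<Rightarrow> real"
  assumes cl: "in_class F p" and x: "filterlim x (endpoint_filter p) sequentially"
    and u: "(\<lambda>n. u n / tail_scale p (x n)) \<longlonglongrightarrow> 0"
  shows "filterlim (\<lambda>n. x n + u n) (endpoint_filter p) sequentially"
    and "(\<lambda>n. lead_tail p (x n + u n) / lead_tail p (x n)) \<longlonglongrightarrow> 1"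
proof -
  have "filterlim (\<lambda>n. x n + u n) (endpoint_filter p) sequentially \<and>
    (\<lambda>n. lead_tail p (x n + u n) / lead_tail p (x n)) \<longlonglongrightarrow> 1"
  proof (cases p)
    case (Hall \<alpha> \<beta> A B)
    have par: "\<alpha> > 0" "A > 0" using cl Hall by auto
    define k where "k = (\<alpha> * (\<alpha> + 1)\<^sup>2) powr (1/3)"
    have k0: "k > 0" using par by (simp add: k_def)
    have x': "filterlim x at_top sequentially" using x Hall by simp
    have xpos: "\<forall>\<^sub>F n in sequentially. x n > 0"
      by (rule eventually_compose_filterlim[OF eventually_gt_at_top x'])
    have "(\<lambda>n. u n / (x n / k) / k) \<longlonglongrightarrow> 0 / k"
      using u by (intro tendsto_divide tendsto_const) (use k0 in \<open>auto simp: Hall k_def\<close>)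
    then have t: "(\<lambda>n. u n / x n) \<longlonglongrightarrow> 0" using k0 by simp
    have t1: "(\<lambda>n. 1 + u n / x n) \<longlonglongrightarrow> 1" using tendsto_add[OF tendsto_const t, of 1] by simp
    have "filterlim (\<lambda>n. (1 + u n / x n) * x n) at_top sequentially"
      by (rule filterlim_tendsto_pos_mult_at_top[OF t1 _ x']) simp
    moreover have ev: "\<forall>\<^sub>F n in sequentially. (1 + u n / x n) * x n = x n + u n"
      using xpos by eventually_elim (simp add: distrib_right)
    ultimately have f: "filterlim (\<lambda>n. x n + u n) at_top sequentially" by (simp add: filterlim_cong)
    have fpos: "\<forall>\<^sub>F n in sequentially. x n + u n > 0"
      by (rule eventually_compose_filterlim[OF eventually_gt_at_top f])
    have "(\<lambda>n. (1 + u n / x n) powr (- \<alpha>)) \<longlonglongrightarrow> 1 powr (- \<alpha>)"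
      by (rule tendsto_powr[OF t1 tendsto_const]) simp
    then have "(\<lambda>n. (1 + u n / x n) powr (- \<alpha>)) \<longlonglongrightarrow> 1" by simp
    moreover have "\<forall>\<^sub>F n in sequentially. (1 + u n / x n) powr (- \<alpha>) = lead_tail p (x n + u n) / lead_tail p (x n)"
      using xpos fpos
    proof eventually_elim
      case (elim n)
      have "1 + u n / x n = (x n + u n) / x n" using elim by (simp add: add_divide_distrib)
      then show ?case using elim par by (simp add: Hall powr_divide)
    qed
    ultimately have "(\<lambda>n. lead_tail p (x n + u n) / lead_tail p (x n)) \<longlonglongrightarrow> 1"
      by (rule Lim_transform_eventually)
    then show ?thesis using f by (simp add: Hall)
  next
    case (Weibull \<kappa> C)
    have par: "\<kappa> > 0" "C > 0" using cl Weibull by auto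
    have x': "filterlim x at_top sequentially" using x Weibull by simp
    have xpos: "\<forall>\<^sub>F n in sequentially. x n > 0"
      by (rule eventually_compose_filterlim[OF eventually_gt_at_top x'])
    have "(\<lambda>n. u n / (x n powr (1 - \<kappa>) / (\<kappa> * C)) / (\<kappa> * C)) \<longlonglongrightarrow> 0 / (\<kappa> * C)"
      using u by (intro tendsto_divide tendsto_const) (use par in \<open>auto simp: Weibull\<close>)
    then have r0: "(\<lambda>n. u n / x n powr (1 - \<kappa>)) \<longlonglongrightarrow> 0" using par by simp
    have r: "(\<lambda>n. x n powr \<kappa> * (u n / x n)) \<longlonglongrightarrow> 0"
      by (rule Lim_transform_eventually[OF r0])
        (use xpos in \<open>eventually_elim, simp add: powr_diff\<close>)
    have neg: "(\<lambda>n. x n powr (- \<kappa>)) \<longlonglongrightarrow> 0"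
      by (rule tendsto_neg_powr[OF _ x']) (use par in simp)
    have t: "(\<lambda>n. u n / x n) \<longlonglongrightarrow> 0"
    proof (rule Lim_transform_eventually)
      show "(\<lambda>n. x n powr (- \<kappa>) * (x n powr \<kappa> * (u n / x n))) \<longlonglongrightarrow> 0"
        using tendsto_mult[OF neg r] by simp
      show "\<forall>\<^sub>F n in sequentially. x n powr (- \<kappa>) * (x n powr \<kappa> * (u n / x n)) = u n / x n"
        using xpos by eventually_elim (simp add: powr_minus)
    qed
    have t1: "(\<lambda>n. 1 + u n / x n) \<longlonglongrightarrow> 1" using tendsto_add[OF tendsto_const t, of 1] by simp
    have "filterlim (\<lambda>n. (1 + u n / x n) * x n) at_top sequentially"
      by (rule filterlim_tendsto_pos_mult_at_top[OF t1 _ x']) simp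
    moreover have ev: "\<forall>\<^sub>F n in sequentially. (1 + u n / x n) * x n = x n + u n"
      using xpos by eventually_elim (simp add: distrib_right)
    ultimately have f: "filterlim (\<lambda>n. x n + u n) at_top sequentially" by (simp add: filterlim_cong)
    have fpos: "\<forall>\<^sub>F n in sequentially. x n + u n > 0"
      by (rule eventually_compose_filterlim[OF eventually_gt_at_top f])
    \<comment> \<open>Caratheodory's difference quotient, which is continuous also where \<open>u n = 0\<close>\<close>
    have "((\<lambda>z. (1 + z) powr \<kappa>) has_real_derivative \<kappa>) (at 0)"
      by (rule derivative_eq_intros refl | simp)+
    then obtain g where g: "\<And>z. (1 + z) powr \<kappa> - (1 + 0) powr \<kappa> = g z * (z - 0)" "isCont g 0" "g 0 = \<kappa>"
      unfolding CARAT_DERIV by blast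
    have gt: "(\<lambda>n. g (u n / x n)) \<longlonglongrightarrow> \<kappa>"
      using isCont_tendsto_compose[OF g(2) t] g(3) by simp
    have "(\<lambda>n. exp (- C * (g (u n / x n) * (x n powr \<kappa> * (u n / x n))))) \<longlonglongrightarrow> exp (- C * (\<kappa> * 0))"
      by (intro tendsto_intros gt r)
    then have "(\<lambda>n. exp (- C * (g (u n / x n) * (x n powr \<kappa> * (u n / x n))))) \<longlonglongrightarrow> 1" by simp
    moreover have "\<forall>\<^sub>F n in sequentially. exp (- C * (g (u n / x n) * (x n powr \<kappa> * (u n / x n)))) = lead_tail p (x n + u n) / lead_tail p (x n)"
      using xpos fpos
    proof eventually_elim
      case (elim n)
      have e: "x n + u n = x n * (1 + u n / x n)" using elim by (simp add: distrib_left)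
      then have "1 + u n / x n > 0" using elim by (simp add: zero_less_mult_iff)
      then have "(x n + u n) powr \<kappa> - x n powr \<kappa> = x n powr \<kappa> * ((1 + u n / x n) powr \<kappa> - 1)"
        by (subst e, subst powr_mult) (simp add: algebra_simps)
      also have "\<dots> = g (u n / x n) * (x n powr \<kappa> * (u n / x n))"
        using g(1)[of "u n / x n"] by simp
      finally have "- C * (g (u n / x n) * (x n powr \<kappa> * (u n / x n))) = - C * (x n + u n) powr \<kappa> - (- C * x n powr \<kappa>)"
        by (metis right_diff_distrib)
      then show ?case by (simp only: Weibull lead_tail.simps exp_diff)
    qed
    ultimately have "(\<lambda>n. lead_tail p (x n + u n) / lead_tail p (x n)) \<longlonglongrightarrow> 1"
      by (rule Lim_transform_eventually)
    then show ?thesis using f by (simp add: Weibull)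
  next
    case (Bounded xs \<mu> \<sigma> D E)
    have par: "\<mu> < -2" "D > 0" using cl Bounded by auto
    define k where "k = (- \<mu> * (\<mu> + 1)\<^sup>2) powr (1/3)"
    have k0: "k > 0" using par unfolding k_def by simp
    have x': "filterlim x (at_left xs) sequentially" using x Bounded by simp
    have xpos: "\<forall>\<^sub>F n in sequentially. xs - x n > 0"
      by (rule eventually_compose_filterlim[OF _ x']) (use eventually_in_domain(3)[of xs] in simp)
    have xl: "(\<lambda>n. x n) \<longlonglongrightarrow> xs" using x' by (simp add: filterlim_at)
    have "(\<lambda>n. u n / ((xs - x n) / k) / k) \<longlonglongrightarrow> 0 / k"
      using u by (intro tendsto_divide tendsto_const) (use k0 in \<open>auto simp: Bounded k_def\<close>)
    then have t: "(\<lambda>n. u n / (xs - x n)) \<longlonglongrightarrow> 0" using k0 by simp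
    have t1: "(\<lambda>n. 1 - u n / (xs - x n)) \<longlonglongrightarrow> 1" using tendsto_diff[OF tendsto_const t, of 1] by simp
    have ev: "\<forall>\<^sub>F n in sequentially. xs - (xs - x n) * (1 - u n / (xs - x n)) = x n + u n"
      using xpos by eventually_elim (simp add: right_diff_distrib)
    have "(\<lambda>n. xs - (xs - x n) * (1 - u n / (xs - x n))) \<longlonglongrightarrow> xs - (xs - xs) * 1"
      by (intro tendsto_intros xl t1)
    then have "(\<lambda>n. xs - (xs - x n) * (1 - u n / (xs - x n))) \<longlonglongrightarrow> xs" by simp
    then have lim: "(\<lambda>n. x n + u n) \<longlonglongrightarrow> xs" using ev by (rule Lim_transform_eventually)
    have "\<forall>\<^sub>F n in sequentially. 1 - u n / (xs - x n) > 0" by (rule order_tendstoD(1)[OF t1]) simp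
    with xpos have fpos: "\<forall>\<^sub>F n in sequentially. xs - (x n + u n) > 0"
      by eventually_elim (simp add: field_simps)
    have f: "filterlim (\<lambda>n. x n + u n) (at_left xs) sequentially"
      unfolding filterlim_at using lim fpos by (auto elim: eventually_mono)
    have "(\<lambda>n. (1 - u n / (xs - x n)) powr (- \<mu>)) \<longlonglongrightarrow> 1 powr (- \<mu>)"
      by (rule tendsto_powr[OF t1 tendsto_const]) simp
    then have "(\<lambda>n. (1 - u n / (xs - x n)) powr (- \<mu>)) \<longlonglongrightarrow> 1" by simp
    moreover have "\<forall>\<^sub>F n in sequentially. (1 - u n / (xs - x n)) powr (- \<mu>) = lead_tail p (x n + u n) / lead_tail p (x n)"
      using xpos fpos
    proof eventually_elim
      case (elim n)
      have "1 - u n / (xs - x n) = (xs - (x n + u n)) / (xs - x n)" using elim by (simp add: field_simps)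
      then show ?case using elim par by (simp add: Bounded powr_divide)
    qed
    ultimately have "(\<lambda>n. lead_tail p (x n + u n) / lead_tail p (x n)) \<longlonglongrightarrow> 1"
      by (rule Lim_transform_eventually)
    then show ?thesis using f by (simp add: Bounded)
  qed
  then show "filterlim (\<lambda>n. x n + u n) (endpoint_filter p) sequentially"
    and "(\<lambda>n. lead_tail p (x n + u n) / lead_tail p (x n)) \<longlonglongrightarrow> 1" by blast+
qed

text \<open>Inverting \<open>m * lead_tail p (x n) \<rightarrow> \<delta>\<close> determines \<open>x n\<close> up to an error of smaller order than the tail
scale. For the power tails this is a power of \<open>\<delta> / m\<close>; in the Weibull class
\<open>C x\<^sup>\<kappa> = ln (m / \<delta>) - ln Q\<close> with \<open>Q \<rightarrow> 1\<close>, and the logarithm of \<open>m / \<delta>\<close> dominates. The constant of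
the scale is exactly the constant of the bandwidth factor.\<close>

lemma tail_scale_asymp:
  fixes x :: "nat \<Rightarrow> real" and m :: "nat \<Rightarrow> nat"
  assumes cl: "in_class F p" and x: "filterlim x (endpoint_filter p) sequentially"
    and m: "filterlim m at_top sequentially" and \<delta>: "\<delta> > 0"
    and M: "(\<lambda>n. real (m n) * lead_tail p (x n)) \<longlonglongrightarrow> \<delta>"
  shows "(\<lambda>n. tail_scale p (x n) / (\<delta> powr (- gam p) * real (m n) powr gam p * bandwidth_factor p (real (m n)) \<delta>)) \<longlonglongrightarrow> 1"
proof -
  have m': "filterlim (\<lambda>n. real (m n)) at_top sequentially"
    by (rule filterlim_compose[OF filterlim_real_sequentially m])
  have ev_m: "\<forall>\<^sub>F n in sequentially. m n > 0"
    by (rule eventually_compose_filterlim[OF eventually_gt_at_top m])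
  define Q where "Q n = real (m n) * lead_tail p (x n) / \<delta>" for n
  have "Q \<longlonglongrightarrow> \<delta> / \<delta>" unfolding Q_def[abs_def] by (intro tendsto_intros M) (use \<delta> in simp)
  then have Q: "Q \<longlonglongrightarrow> 1" using \<delta> by simp
  have ev_Q: "\<forall>\<^sub>F n in sequentially. Q n > 0" by (rule order_tendstoD(1)[OF Q]) simp
  \<comment> \<open>Common to the Hall class, with \<open>y = x\<close> and \<open>a = \<alpha>\<close>, and the bounded class, with \<open>y = xs - x\<close> and \<open>a = \<mu>\<close>\<close>
  have power_tail: "(\<lambda>n. (y n / k) / (\<delta> powr (- g) * real (m n) powr g * (K powr g * c))) \<longlonglongrightarrow> 1"
    if ypos: "\<forall>\<^sub>F n in sequentially. y n > 0" and K: "K > 0" and k: "k > 0" "c = inverse k" and a: "a \<noteq> 0" "g = 1 / a"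
      and tail: "\<And>n. lead_tail p (x n) = K * y n powr (- a)" for y :: "nat \<Rightarrow> real" and k g K c a :: real
  proof (rule Lim_transform_eventually)
    have "(\<lambda>n. Q n powr (- g)) \<longlonglongrightarrow> 1 powr (- g)" by (rule tendsto_powr[OF Q tendsto_const]) simp
    then show "(\<lambda>n. Q n powr (- g)) \<longlonglongrightarrow> 1" by simp
    show "\<forall>\<^sub>F n in sequentially. Q n powr (- g) = (y n / k) / (\<delta> powr (- g) * real (m n) powr g * (K powr g * c))"
      using ypos ev_m
    proof eventually_elim
      case (elim n)
      have "Q n = real (m n) * K / \<delta> * y n powr (- a)" by (simp add: Q_def tail)
      then have "Q n powr (- g) = (real (m n) * K / \<delta>) powr (- g) * (y n powr (- a)) powr (- g)"
        by (simp only: powr_mult)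
      also have "(y n powr (- a)) powr (- g) = y n" using elim a by (simp add: powr_powr)
      also have "(real (m n) * K / \<delta>) powr (- g) = inverse (\<delta> powr (- g) * real (m n) powr g * K powr g)"
        using elim K \<delta> by (simp add: powr_minus powr_divide powr_mult field_simps)
      finally show ?case using k by (simp add: field_simps)
    qed
  qed
  have root: "(a * b\<^sup>2) powr (-1/3) = (sqrt a * b) powr (-2/3)" if "a > 0" "b > 0" for a b :: real
  proof -
    have "(sqrt a * b) powr (-2/3) = ((sqrt a * b) powr 2) powr (-1/3)" by (simp add: powr_powr)
    also have "(sqrt a * b) powr 2 = a * b\<^sup>2" using that by (simp add: power_mult_distrib)
    finally show ?thesis by simp
  qed
  show ?thesis
  proof (cases p)
    case (Hall \<alpha> \<beta> A B)
    have par: "\<alpha> > 0" "A > 0" using cl Hall by auto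
    have pos: "\<forall>\<^sub>F n in sequentially. x n > 0"
      by (rule eventually_compose_filterlim[OF _ x]) (use eventually_in_domain(1) Hall in simp)
    have c: "(sqrt \<alpha> * (\<alpha> + 1)) powr (-2/3) = inverse ((\<alpha> * (\<alpha> + 1)\<^sup>2) powr (1/3))"
      using root[of \<alpha> "\<alpha> + 1"] par powr_minus[of "\<alpha> * (\<alpha> + 1)\<^sup>2" "1/3"] by simp
    have k: "(\<alpha> * (\<alpha> + 1)\<^sup>2) powr (1/3) > 0" using par by simp
    have "lead_tail p (x n) = A * x n powr (- \<alpha>)" for n by (simp add: Hall)
    from power_tail[OF pos par(2) k c _ refl this] par show ?thesis by (simp add: Hall)
  next
    case (Bounded xs \<mu> \<sigma> D E)
    have par: "\<mu> < -2" "D > 0" using cl Bounded by auto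
    have pos: "\<forall>\<^sub>F n in sequentially. xs - x n > 0"
      by (rule eventually_compose_filterlim[OF _ x]) (use eventually_in_domain(3) Bounded in simp)
    have c: "(sqrt (- \<mu>) * (- \<mu> - 1)) powr (-2/3) = inverse ((- \<mu> * (\<mu> + 1)\<^sup>2) powr (1/3))"
    proof -
      have "(- \<mu> - 1)\<^sup>2 = (\<mu> + 1)\<^sup>2" by (simp add: power2_eq_square algebra_simps)
      then show ?thesis
        using root[of "- \<mu>" "- \<mu> - 1"] par powr_minus[of "- \<mu> * (\<mu> + 1)\<^sup>2" "1/3"] by simp
    qed
    have k: "(- \<mu> * (\<mu> + 1)\<^sup>2) powr (1/3) > 0" using par by simp
    have "lead_tail p (x n) = D * (xs - x n) powr (- \<mu>)" for n by (simp add: Bounded)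
    from power_tail[OF pos par(2) k c _ refl this] par show ?thesis by (simp add: Bounded)
  next
    case (Weibull \<kappa> C)
    have par: "\<kappa> > 0" "C > 0" using cl Weibull by auto
    have pos: "\<forall>\<^sub>F n in sequentially. x n > 0"
      by (rule eventually_compose_filterlim[OF _ x]) (use eventually_in_domain(2) Weibull in simp)
    let ?l = "\<lambda>n. ln (real (m n) / \<delta>)"
    have "filterlim (\<lambda>n. inverse \<delta> * real (m n)) at_top sequentially"
      by (rule filterlim_tendsto_pos_mult_at_top[OF tendsto_const _ m']) (use \<delta> in simp)
    then have "filterlim (\<lambda>n. real (m n) / \<delta>) at_top sequentially" by (simp add: field_simps)
    then have l: "filterlim ?l at_top sequentially" by (rule filterlim_compose[OF ln_at_top])
    have ev_l: "\<forall>\<^sub>F n in sequentially. ?l n > 0"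
      by (rule eventually_compose_filterlim[OF eventually_gt_at_top l])
    have "(\<lambda>n. ln (Q n)) \<longlonglongrightarrow> ln 1" by (intro tendsto_ln Q) simp
    then have lq: "(\<lambda>n. ln (Q n) / ?l n) \<longlonglongrightarrow> 0"
      by (rule tendsto_divide_0) (rule filterlim_at_top_imp_at_infinity[OF l])
    have r: "(\<lambda>n. 1 - ln (Q n) / ?l n) \<longlonglongrightarrow> 1" using tendsto_diff[OF tendsto_const lq, of 1] by simp
    show ?thesis
    proof (rule Lim_transform_eventually)
      have "(\<lambda>n. (1 - ln (Q n) / ?l n) powr (- (1 - 1 / \<kappa>))) \<longlonglongrightarrow> 1 powr (- (1 - 1 / \<kappa>))"
        by (rule tendsto_powr[OF r tendsto_const]) simp
      then show "(\<lambda>n. (1 - ln (Q n) / ?l n) powr (- (1 - 1 / \<kappa>))) \<longlonglongrightarrow> 1" by simp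
      show "\<forall>\<^sub>F n in sequentially. (1 - ln (Q n) / ?l n) powr (- (1 - 1 / \<kappa>)) =
          tail_scale p (x n) / (\<delta> powr (- gam p) * real (m n) powr gam p * bandwidth_factor p (real (m n)) \<delta>)"
        using pos ev_m ev_l ev_Q
      proof eventually_elim
        case (elim n)
        have "Q n = real (m n) / \<delta> * exp (- C * x n powr \<kappa>)" by (simp add: Q_def Weibull)
        then have "ln (Q n) = ?l n + ln (exp (- C * x n powr \<kappa>))"
          by (simp only:, subst ln_mult) (use elim \<delta> in auto)
        then have "ln (Q n) = ?l n - C * x n powr \<kappa>" by simp
        then have "1 - ln (Q n) / ?l n = x n powr \<kappa> / (inverse C * ?l n)"
          using elim par by (simp add: field_simps)
        then have "(1 - ln (Q n) / ?l n) powr (- (1 - 1 / \<kappa>)) =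
            (x n powr \<kappa>) powr (- (1 - 1 / \<kappa>)) / (inverse C * ?l n) powr (- (1 - 1 / \<kappa>))"
          using elim par by (simp add: powr_divide)
        also have "(x n powr \<kappa>) powr (- (1 - 1 / \<kappa>)) = x n powr (1 - \<kappa>)"
          using par by (simp add: powr_powr right_diff_distrib)
        finally have "(1 - ln (Q n) / ?l n) powr (- (1 - 1 / \<kappa>)) =
            x n powr (1 - \<kappa>) / (inverse C * ?l n) powr (- (1 - 1 / \<kappa>))" .
        moreover have "a / d = (a / (\<kappa> * C)) / (1 * 1 * (inverse (\<kappa> * C) * d))" for a d
        proof -
          have "a / d = (a / K) / (1 * 1 * (inverse K * d))" if "K \<noteq> 0" for K
            using that by (simp add: field_simps)
          then show ?thesis using par by (metis less_irrefl mult_pos_pos)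
        qed
        moreover have "\<delta> powr (- gam p) = 1" "real (m n) powr gam p = 1" using elim \<delta> by (simp_all add: Weibull)
        ultimately show ?case unfolding Weibull tail_scale.simps bandwidth_factor.simps by (simp only:)
      qed
    qed
  qed
qed

section \<open>The optimal bandwidth and the asymptotic bias\<close>

text \<open>With \<open>4 a h0\<^sup>3 = d\<close> the gap to the value at \<open>h0\<close> is \<open>a (h - h0)\<^sup>2 ((h + h0)\<^sup>2 + 2 h0\<^sup>2)\<close>, so the stationary
point is the only minimizer.\<close>

lemma quartic_argmin_iff:
  fixes a d k :: real
  assumes a: "a > 0" and d: "d > 0" and h0: "h0 > 0" "4 * a * h0 ^ 3 = d"
  shows "is_arg_min (\<lambda>h. a * h ^ 4 + k - d * h) (\<lambda>h. h > 0) b \<longleftrightarrow> b = h0"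
proof -
  let ?f = "\<lambda>h. a * h ^ 4 + k - d * h"
  have gap: "?f h - ?f h0 = a * ((h - h0)\<^sup>2 * ((h + h0)\<^sup>2 + 2 * h0\<^sup>2))" for h
    unfolding h0(2)[symmetric]
    by (simp add: power2_eq_square power3_eq_cube power4_eq_xxxx algebra_simps)
  have pos: "?f h0 < ?f h" if "h \<noteq> h0" for h
  proof -
    have "0 < a * ((h - h0)\<^sup>2 * ((h + h0)\<^sup>2 + 2 * h0\<^sup>2))"
      using a h0 that by (intro mult_pos_pos add_nonneg_pos) auto
    then show ?thesis using gap[of h] by linarith
  qed
  show ?thesis
    using pos h0(1) unfolding is_arg_min_def by (metis less_asym)
qed

text \<open>The criterion is \<open>a h\<^sup>4 - d h\<close> plus a constant; the normalization of the tail scale cancels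
\<open>lead_dens\<close> and \<open>xi\<close> in \<open>d / (4 a)\<close>. At the minimizer the quartic term is a quarter of the linear one.\<close>

lemma opt_bandwidth_closed_form:
  fixes W w :: "real \<Rightarrow> real" and n m :: nat and x :: real and p :: tail_class
  defines "S \<equiv> (LBINT z. z\<^sup>2 * w z)" and "I \<equiv> (LBINT z. z * W z * w z)"
  defines "h0 \<equiv> tail_scale p x * (2 * (real m / real n) * (I / S\<^sup>2) / (real m * lead_tail p x)) powr (1/3)"
  assumes pos: "S > 0" "I > 0" "n > 0" "m > 0" "lead_tail p x > 0" "tail_scale p x > 0" "xi p x > 0"
    and dens: "lead_dens p x = (xi p x)\<^sup>2 * lead_tail p x * tail_scale p x ^ 3"
  shows "is_arg_min (amse p W w n m x) (\<lambda>b. b > 0) b \<longleftrightarrow> b = h0"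
    and "opt_bandwidth p W w n m x = h0"
    and "amse p W w n m x h0 = real m / real n * (real m * lead_tail p x - 3 / 2 * real m * lead_dens p x * I * h0)"
proof -
  define M where "M = real m * lead_tail p x"
  define z where "z = tail_scale p x"
  define a where "a = M\<^sup>2 * ((xi p x)\<^sup>2 / 4) * S\<^sup>2"
  define k where "k = real m / real n * M"
  define d where "d = real m / real n * (2 * real m * lead_dens p x * I)"
  define L where "L = 2 * (real m / real n) * (I / S\<^sup>2) / M"
  have M0: "M > 0" using pos by (simp add: M_def)
  have z0: "z > 0" using pos by (simp add: z_def)
  have L0: "L > 0" using pos M0 by (simp add: L_def)
  have h0_eq: "h0 = z * L powr (1/3)" by (simp add: h0_def z_def L_def M_def)
  have h0: "h0 > 0" using z0 L0 by (simp add: h0_eq)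
  have a0: "a > 0" using pos M0 by (simp add: a_def)
  have d_eq: "d = 2 * (real m / real n) * M * (xi p x)\<^sup>2 * z ^ 3 * I"
    by (simp add: d_def dens M_def z_def)
  have d0: "d > 0" using pos M0 z0 by (simp add: d_eq)
  have cube: "4 * a * h0 ^ 3 = d"
  proof -
    have "h0 ^ 3 = z ^ 3 * L"
      using powr_third_cube[of L] L0 by (simp add: h0_eq power_mult_distrib)
    then have "4 * a * h0 ^ 3 = M\<^sup>2 * (xi p x)\<^sup>2 * S\<^sup>2 * (z ^ 3 * L)" by (simp add: a_def)
    also have "\<dots> = d" using pos M0 unfolding L_def d_eq by (simp add: field_simps power2_eq_square)
    finally show ?thesis .
  qed
  have amse: "amse p W w n m x = (\<lambda>h. a * h ^ 4 + k - d * h)"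
    by (rule ext) (simp add: amse_def a_def k_def d_def S_def I_def M_def algebra_simps)
  show iff: "is_arg_min (amse p W w n m x) (\<lambda>b. b > 0) b \<longleftrightarrow> b = h0" for b
    unfolding amse by (rule quartic_argmin_iff[OF a0 d0 h0 cube])
  show "opt_bandwidth p W w n m x = h0"
    unfolding opt_bandwidth_def arg_min_def iff by simp
  have "amse p W w n m x h0 = (4 * a * h0 ^ 3) * h0 / 4 + k - d * h0"
    unfolding amse by (simp add: power3_eq_cube power4_eq_xxxx)
  also have "\<dots> = k - 3 / 4 * d * h0" unfolding cube by simp
  finally show "amse p W w n m x h0 = real m / real n * (real m * lead_tail p x - 3 / 2 * real m * lead_dens p x * I * h0)"
    by (simp add: k_def d_def M_def algebra_simps)
qed

text \<open>\<open>1 - q\<close> and \<open>exp (- q)\<close> differ by at most \<open>q\<^sup>2\<close>, hence their powers by at most \<open>m q\<^sup>2\<close>.\<close>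

lemma one_minus_power_tendsto_exp:
  fixes q :: "nat \<Rightarrow> real" and m :: "nat \<Rightarrow> nat"
  assumes q01: "\<And>n. 0 \<le> q n" "\<And>n. q n \<le> 1"
    and m: "filterlim m at_top sequentially" and lim: "(\<lambda>n. real (m n) * q n) \<longlonglongrightarrow> \<delta>"
  shows "(\<lambda>n. (1 - q n) ^ m n) \<longlonglongrightarrow> exp (- \<delta>)"
proof -
  have m': "filterlim (\<lambda>n. real (m n)) at_top sequentially"
    by (rule filterlim_compose[OF filterlim_real_sequentially m])
  have ev_m: "\<forall>\<^sub>F n in sequentially. m n > 0"
    by (rule eventually_compose_filterlim[OF eventually_gt_at_top m])
  have "(\<lambda>n. real (m n) * q n / real (m n)) \<longlonglongrightarrow> 0"
    by (rule tendsto_divide_0[OF lim filterlim_at_top_imp_at_infinity[OF m']])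
  then have q0: "q \<longlonglongrightarrow> 0"
    by (rule Lim_transform_eventually) (use ev_m in \<open>eventually_elim, simp\<close>)
  have bound: "norm ((1 - q n) ^ m n - exp (- (real (m n) * q n))) \<le> real (m n) * q n * q n" for n
  proof -
    have lo: "1 - q n \<le> exp (- q n)" using exp_ge_add_one_self[of "- q n"] by simp
    have "1 \<le> 1 + q n ^ 3" using q01[of n] by simp
    also have "\<dots> = (1 - q n + (q n)\<^sup>2) * (1 + q n)"
      by (simp add: power2_eq_square power3_eq_cube algebra_simps)
    also have "\<dots> \<le> (1 - q n + (q n)\<^sup>2) * exp (q n)"
      using q01[of n] by (intro mult_left_mono exp_ge_add_one_self) auto
    finally have up: "exp (- q n) \<le> 1 - q n + (q n)\<^sup>2" by (simp add: exp_minus field_simps)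
    have "norm ((1 - q n) ^ m n - exp (- q n) ^ m n) \<le> real (m n) * norm ((1 - q n) - exp (- q n))"
      by (rule norm_power_diff) (use q01[of n] in auto)
    also have "\<dots> \<le> real (m n) * (q n)\<^sup>2" by (intro mult_left_mono) (use lo up in auto)
    finally show ?thesis by (simp add: power2_eq_square exp_of_nat_mult[symmetric])
  qed
  have "(\<lambda>n. real (m n) * q n * q n) \<longlonglongrightarrow> 0" using tendsto_mult[OF lim q0] by simp
  then have "(\<lambda>n. (1 - q n) ^ m n - exp (- (real (m n) * q n))) \<longlonglongrightarrow> 0"
    by (rule Lim_null_comparison[rotated]) (use bound in auto)
  moreover have "(\<lambda>n. exp (- (real (m n) * q n))) \<longlonglongrightarrow> exp (- \<delta>)"
    by (intro tendsto_intros lim)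
  ultimately show ?thesis by (rule Lim_transform[rotated])
qed

text \<open>An observation above \<open>x + k h\<close> contributes at least \<open>W k\<close> to \<open>1 - W ((x - X) / h)\<close>, by the symmetry of
the kernel. For large \<open>k\<close> this keeps smoothing from reducing the variance of the estimator to leading
order.\<close>

lemma (in prob_space) kernel_tail_second_moment_ge:
  fixes X :: "'a \<Rightarrow> real"
  assumes K: "smoothing_kernel W w" and [measurable]: "X \<in> borel_measurable M" and h: "h > 0"
  shows "(W k)\<^sup>2 * (1 - prob {\<omega> \<in> space M. X \<omega> \<le> x + k * h}) \<le> expectation (\<lambda>\<omega>. (1 - W ((x - X \<omega>) / h))\<^sup>2)"
proof -
  have contW: "continuous_on UNIV W" and mono: "mono W"
    using K by (auto simp: smoothing_kernel_def intro!: continuous_at_imp_continuous_on DERIV_isCont)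
  have [measurable]: "W \<in> borel_measurable borel" by (rule borel_measurable_continuous_onI[OF contW])
  let ?A = "{\<omega> \<in> space M. x + k * h < X \<omega>}"
  have "1 - prob {\<omega> \<in> space M. X \<omega> \<le> x + k * h} = prob {\<omega> \<in> space M. \<not> X \<omega> \<le> x + k * h}"
    by (rule prob_neg[symmetric]) measurable
  also have "{\<omega> \<in> space M. \<not> X \<omega> \<le> x + k * h} = ?A" by (auto simp: not_le)
  finally have "(W k)\<^sup>2 * (1 - prob {\<omega> \<in> space M. X \<omega> \<le> x + k * h}) = expectation (\<lambda>\<omega>. (W k)\<^sup>2 * indicator ?A \<omega>)"
    by simp
  also have "\<dots> \<le> expectation (\<lambda>\<omega>. (1 - W ((x - X \<omega>) / h))\<^sup>2)"
  proof (rule integral_mono)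
    show "integrable M (\<lambda>\<omega>. (W k)\<^sup>2 * indicator ?A \<omega>)"
      by (intro integrable_mult_right integrable_real_indicator) (auto simp: less_top[symmetric])
    show "integrable M (\<lambda>\<omega>. (1 - W ((x - X \<omega>) / h))\<^sup>2)"
      by (rule integrable_const_bound[where B = 1])
        (use kernel_range[OF K] in \<open>auto simp: abs_square_le_1 abs_le_iff add_increasing2\<close>)
    fix \<omega> assume "\<omega> \<in> space M"
    show "(W k)\<^sup>2 * indicator ?A \<omega> \<le> (1 - W ((x - X \<omega>) / h))\<^sup>2"
    proof (cases "\<omega> \<in> ?A")
      case True
      then have "k \<le> - ((x - X \<omega>) / h)" using h by (simp add: field_simps)
      then have "W k \<le> W (- ((x - X \<omega>) / h))" by (rule monoD[OF mono])
      also have "\<dots> = 1 - W ((x - X \<omega>) / h)" by (rule kernel_reflect[OF K])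
      finally show ?thesis using True kernel_range(1)[OF K] by (simp add: power_mono)
    qed simp
  qed
  finally show ?thesis .
qed

text \<open>The bandwidth is \<open>z n * L n powr (1/3)\<close> with the tail scale \<open>z n\<close> and \<open>L n\<close> of order \<open>m / n\<close>. It is
therefore small on the tail scale, so that shifts by multiples of it do not affect the tail, and the
\<open>h\<close>-dependent part of the criterion is of smaller order than \<open>m / n\<close>.\<close>

theorem corollary3:
  fixes P :: "'a measure" and X :: "nat \<Rightarrow> 'a \<Rightarrow> real"
    and f F W w :: "real \<Rightarrow> real" and p :: tail_class
    and m :: "nat \<Rightarrow> nat" and x :: "nat \<Rightarrow> real" and \<delta> :: real
  defines "S \<equiv> (LBINT z. z\<^sup>2 * w z)"
    and "I \<equiv> (LBINT z. z * W z * w z)"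
    and "\<gamma> \<equiv> gam p"
    and "h \<equiv> (\<lambda>n. opt_bandwidth p W w n (m n) (x n))"
  assumes "prob_space P"
    and "prob_space.indep_vars P (\<lambda>_. borel) X UNIV"
    and "\<And>i. distributed P lborel (X i) (\<lambda>y. ennreal (f y))"
    and "\<And>y. f y \<ge> 0"
    and "\<And>y. F y = measure P {\<omega> \<in> space P. X 0 \<omega> \<le> y}"
    and "in_class F p"
    and "smoothing_kernel W w"
    and "(\<exists>a b. F a = 0 \<and> F b = 1) \<longrightarrow> bounded {z. w z \<noteq> 0}"
    and "filterlim m at_top sequentially"
    and "(\<lambda>n. real (m n) / real n) \<longlonglongrightarrow> 0"
    and "filterlim x (endpoint_filter p) sequentially"
    and "\<forall>\<^sub>F n in sequentially. cont_twice_diff_at F (x n)"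
    and "integrable lborel (\<lambda>z. z\<^sup>2 * w z)"
    and "integrable lborel (\<lambda>z. z * W z * w z)"
    and "(\<lambda>n. inverse ((xi p (x n))\<^sup>2) * psi p (x n) * inverse (real n)) \<longlonglongrightarrow> 0"
    and "\<delta> > 0"
    and "(\<lambda>n. real (m n) * lead_tail p (x n)) \<longlonglongrightarrow> \<delta>"
  shows "(\<forall>\<^sub>F n in sequentially. \<exists>!b. is_arg_min (amse p W w n (m n) (x n)) (\<lambda>b. b > 0) b) \<and>
    h \<sim>[sequentially]
      (\<lambda>n. (2 * \<delta> powr (-1 - 3 * \<gamma>) * real (m n) powr (1 + 3 * \<gamma>) * inverse (real n) * (I / S\<^sup>2))
             powr (1/3) * bandwidth_factor p (real (m n)) \<delta>) \<and>
    (h \<longlonglongrightarrow> 0 \<longrightarrow>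
     (\<lambda>n. exp (2 * (real (m n) * lead_tail p (x n))) *
          (\<integral>\<omega>. (F (x n) ^ m n - Fhat W (h n) n X (x n) \<omega> ^ m n)\<^sup>2 \<partial>P))
       \<sim>[sequentially] (\<lambda>n. amse p W w n (m n) (x n) (h n)) \<longrightarrow>
     has_asymptotic_bias P
       (\<lambda>n \<omega>. F (x n) ^ m n - Fhat W (h n) n X (x n) \<omega> ^ m n)
       (\<lambda>n. (2 * S) powr (-1/3) * I powr (2/3) * exp (-\<delta>) * \<delta> powr (1/3) *
             real (m n) powr (2/3) * real n powr (-2/3) * bias_factor p))"
proof -
  note prob = assms(5) and indep = assms(6) and dist = assms(7) and f0 = assms(8) and F = assms(9)
    and cl = assms(10) and ker = assms(11) and m_inf = assms(13) and mn = assms(14) and x = assms(15)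
    and intS = assms(17) and intI = assms(18) and \<delta> = assms(20) and M_lim = assms(21)
  interpret prob_space P by (rule prob)
  have S0: "S > 0" unfolding S_def by (rule kernel_second_moment_pos[OF ker intS])
  have I0: "I > 0" unfolding I_def by (rule kernel_mixed_moment_pos[OF ker intI])
  define T where "T n = lead_tail p (x n)" for n
  define Mn where "Mn n = real (m n) * T n" for n
  define z where "z n = tail_scale p (x n)" for n
  have M_lim': "Mn \<longlonglongrightarrow> \<delta>" unfolding Mn_def[abs_def] T_def by (rule M_lim)
  have ev_m: "\<forall>\<^sub>F n in sequentially. m n > 0"
    by (rule eventually_compose_filterlim[OF eventually_gt_at_top m_inf])
  have ev_n: "\<forall>\<^sub>F n in sequentially. n > (0::nat)" by (rule eventually_gt_at_top)
  obtain c where c: "c > 0" and tail: "\<forall>\<^sub>F y in endpoint_filter p. lead_tail p y > 0 \<and> tail_scale p y > 0 \<and>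
      xi p y * (tail_scale p y)\<^sup>2 = c \<and> lead_dens p y = (xi p y)\<^sup>2 * lead_tail p y * tail_scale p y ^ 3"
    by (rule tail_scale_identities[OF cl])
  have ev_tail: "\<forall>\<^sub>F n in sequentially. T n > 0 \<and> z n > 0 \<and> xi p (x n) * (z n)\<^sup>2 = c \<and> xi p (x n) > 0 \<and>
      lead_dens p (x n) = (xi p (x n))\<^sup>2 * T n * z n ^ 3"
    using eventually_compose_filterlim[OF tail x]
  proof eventually_elim
    case (elim n)
    then have "xi p (x n) * (tail_scale p (x n))\<^sup>2 > 0" using c by simp
    then have "xi p (x n) > 0" by (simp add: zero_less_mult_iff)
    then show ?case using elim by (simp add: T_def z_def)
  qed
  define L where "L n = 2 * (real (m n) / real n) * (I / S\<^sup>2) / Mn n" for n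
  have closed: "\<forall>\<^sub>F n in sequentially. (\<forall>b. is_arg_min (amse p W w n (m n) (x n)) (\<lambda>b. b > 0) b \<longleftrightarrow> b = h n) \<and>
      h n = z n * L n powr (1/3) \<and>
      amse p W w n (m n) (x n) (h n) = real (m n) / real n * (Mn n - 3 / 2 * real (m n) * lead_dens p (x n) * I * h n)"
    using ev_m ev_n ev_tail
  proof eventually_elim
    case (elim n)
    have dens: "lead_dens p (x n) = (xi p (x n))\<^sup>2 * lead_tail p (x n) * tail_scale p (x n) ^ 3"
      and pos: "lead_tail p (x n) > 0" "tail_scale p (x n) > 0" "xi p (x n) > 0"
      using elim by (auto simp: T_def z_def)
    note O = opt_bandwidth_closed_form[OF S0[unfolded S_def] I0[unfolded I_def] elim(2,1) pos dens]
    show ?case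
      unfolding h_def L_def Mn_def T_def z_def S_def I_def O(2) using O(1,3) by simp
  qed
  have ev_M: "\<forall>\<^sub>F n in sequentially. Mn n > 0" by (rule order_tendstoD(1)[OF M_lim' \<delta>])
  have L_lim: "L \<longlonglongrightarrow> 0"
  proof -
    have "L \<longlonglongrightarrow> 2 * 0 * (I / S\<^sup>2) / \<delta>"
      unfolding L_def[abs_def] by (intro tendsto_intros mn M_lim') (use \<delta> in simp)
    then show ?thesis by simp
  qed
  have hz: "(\<lambda>n. h n / z n) \<longlonglongrightarrow> 0"
  proof (rule Lim_transform_eventually)
    have "(\<lambda>n. L n powr (1/3)) \<longlonglongrightarrow> 0 powr (1/3)"
    proof (rule tendsto_powr2[OF L_lim tendsto_const])
      show "\<forall>\<^sub>F n in sequentially. 0 \<le> L n" using ev_M by eventually_elim (use I0 in \<open>simp add: L_def\<close>)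
    qed simp
    then show "(\<lambda>n. L n powr (1/3)) \<longlonglongrightarrow> 0" by simp
    show "\<forall>\<^sub>F n in sequentially. L n powr (1/3) = h n / z n"
      using closed ev_tail by eventually_elim simp
  qed
  have ev_h: "\<forall>\<^sub>F n in sequentially. h n > 0"
    using closed
  proof eventually_elim
    case (elim n)
    then have "is_arg_min (amse p W w n (m n) (x n)) (\<lambda>b. b > 0) (h n)" by blast
    then show ?case unfolding is_arg_min_def by blast
  qed
  have unique: "\<forall>\<^sub>F n in sequentially. \<exists>!b. is_arg_min (amse p W w n (m n) (x n)) (\<lambda>b. b > 0) b"
    using closed
  proof eventually_elim
    case (elim n)
    then show ?case by (intro ex1I[of _ "h n"]) blast+
  qed

  let ?H = "\<lambda>n. (2 * \<delta> powr (-1 - 3 * \<gamma>) * real (m n) powr (1 + 3 * \<gamma>) * inverse (real n) * (I / S\<^sup>2))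
             powr (1/3) * bandwidth_factor p (real (m n)) \<delta>"
  have bandwidth: "h \<sim>[sequentially] ?H"
  proof (rule asymp_equivI', rule Lim_transform_eventually)
    let ?r = "\<lambda>n. tail_scale p (x n) / (\<delta> powr (- gam p) * real (m n) powr gam p * bandwidth_factor p (real (m n)) \<delta>)"
    have "(\<lambda>n. ?r n * (\<delta> / Mn n) powr (1/3)) \<longlonglongrightarrow> 1 * (\<delta> / \<delta>) powr (1/3)"
      by (intro tendsto_mult tail_scale_asymp[OF cl x m_inf \<delta> M_lim] tendsto_powr tendsto_divide
          tendsto_const M_lim') (use \<delta> in auto)
    then show "(\<lambda>n. ?r n * (\<delta> / Mn n) powr (1/3)) \<longlonglongrightarrow> 1" using \<delta> by simp
    show "\<forall>\<^sub>F n in sequentially. ?r n * (\<delta> / Mn n) powr (1/3) = h n / ?H n"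
      using closed ev_m ev_n ev_M
    proof eventually_elim
      case (elim n)
      let ?L = "2 * (real (m n) / real n) * (I / S\<^sup>2)"
      have L0: "?L > 0" using elim S0 I0 by simp
      have "2 * \<delta> powr (-1 - 3 * \<gamma>) * real (m n) powr (1 + 3 * \<gamma>) * inverse (real n) * (I / S\<^sup>2)
          = (?L / \<delta>) * (\<delta> powr (- 3 * \<gamma>) * real (m n) powr (3 * \<gamma>))"
      proof -
        have "\<delta> powr (-1 - 3 * \<gamma>) = \<delta> powr (- 3 * \<gamma>) / \<delta>"
        proof -
          have "-1 - 3 * \<gamma> = - 3 * \<gamma> - 1" by simp
          then show ?thesis using \<delta> by (simp only: powr_diff powr_one)
        qed
        moreover have "real (m n) powr (1 + 3 * \<gamma>) = real (m n) * real (m n) powr (3 * \<gamma>)"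
          using elim by (simp add: powr_add)
        ultimately show ?thesis by (simp only: divide_inverse mult_ac)
      qed
      then have "(2 * \<delta> powr (-1 - 3 * \<gamma>) * real (m n) powr (1 + 3 * \<gamma>) * inverse (real n) * (I / S\<^sup>2)) powr (1/3)
          = (?L / \<delta>) powr (1/3) * (\<delta> powr (- \<gamma>) * real (m n) powr \<gamma>)"
        by (simp only: powr_mult powr_powr) simp
      moreover have "(\<delta> / Mn n) powr (1/3) = L n powr (1/3) / (?L / \<delta>) powr (1/3)"
      proof -
        have "\<delta> / Mn n = L n / (?L / \<delta>)"
          using L0 \<delta> elim S0 I0 by (simp add: L_def field_simps)
        then show ?thesis by (simp only: powr_divide)
      qed
      ultimately show ?case using elim by (simp add: z_def \<gamma>_def)
    qed
  qed

  \<comment> \<open>\<open>m * lead_dens * h = M c\<^sup>2 (h / z)\<close>, so only the constant term of the criterion survives\<close>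
  have amse_lim: "(\<lambda>n. real n / real (m n) * amse p W w n (m n) (x n) (h n)) \<longlonglongrightarrow> \<delta>"
  proof (rule Lim_transform_eventually)
    have "(\<lambda>n. Mn n - 3 / 2 * I * (Mn n * c\<^sup>2 * (h n / z n))) \<longlonglongrightarrow> \<delta> - 3 / 2 * I * (\<delta> * c\<^sup>2 * 0)"
      by (intro tendsto_intros M_lim' hz)
    then show "(\<lambda>n. Mn n - 3 / 2 * I * (Mn n * c\<^sup>2 * (h n / z n))) \<longlonglongrightarrow> \<delta>" by simp
    show "\<forall>\<^sub>F n in sequentially. Mn n - 3 / 2 * I * (Mn n * c\<^sup>2 * (h n / z n)) =
        real n / real (m n) * amse p W w n (m n) (x n) (h n)"
      using closed ev_m ev_n ev_tail
    proof eventually_elim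
      case (elim n)
      have "c\<^sup>2 = (xi p (x n))\<^sup>2 * z n ^ 4" using elim by (auto simp: power_mult_distrib)
      then have "Mn n * c\<^sup>2 * (h n / z n) = real (m n) * lead_dens p (x n) * h n"
        using elim by (simp add: Mn_def power3_eq_cube power4_eq_xxxx)
      moreover have "real n / real (m n) * amse p W w n (m n) (x n) (h n) =
          Mn n - 3 / 2 * real (m n) * lead_dens p (x n) * I * h n"
      proof -
        have e: "amse p W w n (m n) (x n) (h n) =
          real (m n) / real n * (Mn n - 3 / 2 * real (m n) * lead_dens p (x n) * I * h n)"
          using elim(1) by blast
        show ?thesis unfolding e using elim(2,3) by simp
      qed
      ultimately show ?case by simp
    qed
  qed

  have contW: "continuous_on UNIV W"
    using ker by (auto simp: smoothing_kernel_def intro!: continuous_at_imp_continuous_on DERIV_isCont)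
  have [measurable]: "W \<in> borel_measurable borel" by (rule borel_measurable_continuous_onI[OF contW])
  have Xm [measurable]: "X i \<in> borel_measurable P" for i
    using indep unfolding indep_vars_def2 by simp
  have F01: "0 \<le> F y" "F y \<le> 1" for y by (simp_all add: F)
  have law: "expectation (\<lambda>\<omega>. g (X i \<omega>)) = (LBINT y. f y * g y)" if "g \<in> borel_measurable borel" for i and g :: "real \<Rightarrow> real"
    by (rule distributed_integral[OF dist, symmetric]) (use f0 that in auto)

  have tail_lim: "(\<lambda>n. real (m n) * (1 - F (x n + u n))) \<longlonglongrightarrow> \<delta>"
    if u: "(\<lambda>n. u n / z n) \<longlonglongrightarrow> 0" for u
  proof (rule Lim_transform_eventually)
    note sh = lead_tail_shift[OF cl x u[unfolded z_def]]
    have "(\<lambda>n. Mn n * (lead_tail p (x n + u n) / T n) * ((1 - F (x n + u n)) / lead_tail p (x n + u n))) \<longlonglongrightarrow> \<delta> * 1 * 1"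
      unfolding T_def by (intro tendsto_mult M_lim' sh(2) filterlim_compose[OF lead_tail_asymp[OF cl] sh(1)])
    then show "(\<lambda>n. Mn n * (lead_tail p (x n + u n) / T n) * ((1 - F (x n + u n)) / lead_tail p (x n + u n))) \<longlonglongrightarrow> \<delta>" by simp
    show "\<forall>\<^sub>F n in sequentially. Mn n * (lead_tail p (x n + u n) / T n) * ((1 - F (x n + u n)) / lead_tail p (x n + u n))
        = real (m n) * (1 - F (x n + u n))"
      using ev_tail eventually_compose_filterlim[OF tail sh(1)] by eventually_elim (simp add: Mn_def)
  qed
  have F_lim: "(\<lambda>n. F (x n) ^ m n) \<longlonglongrightarrow> exp (- \<delta>)"
  proof -
    have "(\<lambda>n. real (m n) * (1 - F (x n))) \<longlonglongrightarrow> \<delta>" using tail_lim[of "\<lambda>_. 0"] by simp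
    from one_minus_power_tendsto_exp[OF _ _ m_inf this] F01 show ?thesis by simp
  qed
  define r where "r n = (LBINT y. f y * (1 - W ((x n - y) / h n))\<^sup>2)" for n
  have second: "expectation (\<lambda>\<omega>. (1 - W ((x n - X i \<omega>) / h n))\<^sup>2) = r n" for n i
    unfolding r_def by (rule law[of "\<lambda>y. (1 - W ((x n - y) / h n))\<^sup>2"]) measurable
  have lower: "\<forall>\<^sub>F n in sequentially. \<delta> - \<eta> \<le> real (m n) * r n" if \<eta>: "\<eta> > 0" for \<eta>
  proof -
    have "((\<lambda>k. (W k)\<^sup>2 * \<delta>) \<longlongrightarrow> 1\<^sup>2 * \<delta>) at_top"
      using ker by (intro tendsto_intros) (simp add: smoothing_kernel_def)
    then have "\<forall>\<^sub>F k in at_top. (W k)\<^sup>2 * \<delta> > \<delta> - \<eta>" by (rule order_tendstoD(1)) (use \<eta> in simp)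
    then obtain k where k: "(W k)\<^sup>2 * \<delta> > \<delta> - \<eta>" by (auto simp: eventually_at_top_linorder)
    have "(\<lambda>n. k * h n / z n) \<longlonglongrightarrow> 0" using tendsto_mult[OF tendsto_const hz, of k] by simp
    then have "(\<lambda>n. (W k)\<^sup>2 * (real (m n) * (1 - F (x n + k * h n)))) \<longlonglongrightarrow> (W k)\<^sup>2 * \<delta>"
      by (intro tendsto_intros tail_lim)
    then have "\<forall>\<^sub>F n in sequentially. \<delta> - \<eta> < (W k)\<^sup>2 * (real (m n) * (1 - F (x n + k * h n)))"
      by (rule order_tendstoD(1)) (rule k)
    with ev_h show ?thesis
    proof eventually_elim
      case (elim n)
      have "(W k)\<^sup>2 * (1 - F (x n + k * h n)) \<le> r n"
        using kernel_tail_second_moment_ge[OF ker Xm elim(1), of k 0 "x n"] unfolding second F .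
      then have "real (m n) * ((W k)\<^sup>2 * (1 - F (x n + k * h n))) \<le> real (m n) * r n"
        by (rule mult_left_mono) simp
      then show ?case using elim(2) by (simp add: mult_ac)
    qed
  qed
  have bias: "has_asymptotic_bias P
       (\<lambda>n \<omega>. F (x n) ^ m n - Fhat W (h n) n X (x n) \<omega> ^ m n)
       (\<lambda>n. (2 * S) powr (-1/3) * I powr (2/3) * exp (-\<delta>) * \<delta> powr (1/3) *
             real (m n) powr (2/3) * real n powr (-2/3) * bias_factor p)" (is "has_asymptotic_bias P _ ?b")
    if eq: "(\<lambda>n. exp (2 * (real (m n) * lead_tail p (x n))) *
          (\<integral>\<omega>. (F (x n) ^ m n - Fhat W (h n) n X (x n) \<omega> ^ m n)\<^sup>2 \<partial>P))
       \<sim>[sequentially] (\<lambda>n. amse p W w n (m n) (x n) (h n))"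
  proof -
    let ?E = "\<lambda>n. (\<integral>\<omega>. (F (x n) ^ m n - Fhat W (h n) n X (x n) \<omega> ^ m n)\<^sup>2 \<partial>P)"
    have "(\<lambda>n. real n / real (m n) * (exp (2 * Mn n) * ?E n)) \<sim>[sequentially]
        (\<lambda>n. real n / real (m n) * amse p W w n (m n) (x n) (h n))"
      by (rule asymp_equiv_mult[OF asymp_equiv_refl eq[folded T_def, folded Mn_def]])
    from asymp_equiv_tendsto_transfer[OF asymp_equiv_symI[OF this] amse_lim]
    have "(\<lambda>n. real n / real (m n) * (exp (2 * Mn n) * ?E n)) \<longlonglongrightarrow> \<delta>" .
    then have "(\<lambda>n. real n / real (m n) * (exp (2 * Mn n) * ?E n) * exp (- 2 * Mn n)) \<longlonglongrightarrow> \<delta> * exp (- 2 * \<delta>)"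
      by (intro tendsto_intros M_lim')
    moreover have cancel: "real n / real (m n) * (exp (2 * Mn n) * ?E n) * exp (- 2 * Mn n) = real n / real (m n) * ?E n" for n
      by (simp add: exp_minus)
    ultimately have mse: "(\<lambda>n. real n / real (m n) * ?E n) \<longlonglongrightarrow> \<delta> * exp (- 2 * \<delta>)" unfolding cancel by blast
    \<comment> \<open>\<open>2/3 - 1/2 = 1/6\<close>: the claimed bias is of smaller order than the standard deviation\<close>
    have b: "(\<lambda>n. ?b n / sqrt (real (m n) / real n)) \<longlonglongrightarrow> 0"
    proof (rule Lim_transform_eventually)
      let ?C = "(2 * S) powr (-1/3) * I powr (2/3) * exp (-\<delta>) * \<delta> powr (1/3) * bias_factor p"
      have "(\<lambda>n. (real (m n) / real n) powr (1/6)) \<longlonglongrightarrow> 0 powr (1/6)"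
        by (rule tendsto_powr2[OF mn tendsto_const]) auto
      from tendsto_mult[OF tendsto_const this, of ?C]
      show "(\<lambda>n. ?C * (real (m n) / real n) powr (1/6)) \<longlonglongrightarrow> 0" by simp
      show "\<forall>\<^sub>F n in sequentially. ?C * (real (m n) / real n) powr (1/6) = ?b n / sqrt (real (m n) / real n)"
        using ev_m ev_n
      proof eventually_elim
        case (elim n)
        define q where "q = real (m n) / real n"
        have q0: "q > 0" using elim by (simp add: q_def)
        have "real (m n) powr (2/3) * real n powr (-2/3) = q powr (2/3)"
          using powr_minus[of "real n" "2/3"] by (simp add: q_def powr_divide field_simps)
        then have "?b n = ?C * q powr (2/3)" by (simp add: mult_ac)
        moreover have "q powr (2/3) / sqrt q = q powr (1/6)"
          using powr_diff[of q "2/3" "1/2"] q0 by (simp add: powr_half_sqrt)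
        ultimately have "?b n / sqrt q = ?C * q powr (1/6)" by (simp only: times_divide_eq_right[symmetric])
        then show ?case by (simp add: q_def)
      qed
    qed
    define q where "q n = 1 - (LBINT y. f y * W ((x n - y) / h n))" for n
    have "\<exists>s. (\<forall>n. s n > 0) \<and>
      weak_conv_m (\<lambda>n. distr P borel (\<lambda>\<omega>. (F (x n) ^ m n - ((\<Sum>i<n. W ((x n - X i \<omega>) / h n)) / real n) ^ m n - ?b n) / s n)) std_normal_distribution"
    proof (rule power_of_mean_asymptotic_normality[where q = q and r = r and \<delta> = \<delta>])
      show "indep_vars (\<lambda>_. borel) (\<lambda>i \<omega>. W ((x n - X i \<omega>) / h n)) UNIV" for n
        by (rule indep_vars_compose2[OF indep]) measurable
      show "0 \<le> W ((x n - X i \<omega>) / h n) \<and> W ((x n - X i \<omega>) / h n) \<le> 1" for n i \<omega>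
        using kernel_range[OF ker] by blast
      show "expectation (\<lambda>\<omega>. W ((x n - X i \<omega>) / h n)) = 1 - q n" for n i
        using law[of "\<lambda>y. W ((x n - y) / h n)" i] by (simp add: q_def)
    qed (use second m_inf mn \<delta> F_lim lower mse[unfolded Fhat_def] b in auto)
    then show ?thesis unfolding has_asymptotic_bias_def Fhat_def
      by - (rule exI[of _ ?b], simp)
  qed
  show ?thesis using unique bandwidth bias by blast
qed

end
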